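(* Let $M,N\ge0$ be integers. Let $X_1,\ldots,X_M,Y_1,\ldots,Y_N$ be independent random variables with $X_i\sim N(0,\sigma_{X_i}^2)$ and $Y_j\sim N(0,\sigma_{Y_j}^2)$, and let $Z=X/Y$ with $X=X_1\cdots X_M$ and $Y=Y_1\cdots Y_N$. Let $\varphi_Z(t)=\mathbb{E}[\mathrm{e}^{\mathrm{i}tZ}]$. (i) Suppose $M\ge1$ and $N\ge0$. Then, for $t\in\mathbb{R}$, $$\varphi_Z(t)=\frac{1}{\pi^{(N+M-1)/2}}\,G^{N+1,M-1}_{M-1,N+1}\bigg(\frac{2^M\sigma_M^2t^2}{2^{N+2}s_N^2}\;\bigg|\;{\frac12,\ldots,\frac12\atop 0,\frac12,\ldots,\frac12}\bigg),$$ where the upper parameters are $M-1$ copies of $\frac12$ and the lower parameters are $0$ followed by $N$ copies of $\frac12$. (ii) Suppose $M=0$ and $N\ge1$. Then, for $t\in\mathbb{R}$, $$\varphi_Z(t)=\frac{1}{\pi^{(N-1)/2}}\,G^{N+1,0}_{0,N+2}\bigg(\frac{t^2}{2^{N+2}s_N^2}\;\bigg|\;{-\atop 0,\frac12,\ldots,\frac12}\bigg),$$ where there are no upper parameters and the lower parameters are $0$ followed by $N+1$ copies of $\frac12$.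
   Context: All standard deviations $\sigma_{X_i},\sigma_{Y_j}$ are positive. Notation: $\sigma_M=\sigma_{X_1}\cdots\sigma_{X_M}$ and $s_N=\sigma_{Y_1}\cdots\sigma_{Y_N}$. Empty products are $1$: thus $\sigma_0=1$, $s_0=1$, $X=1$ when $M=0$, and $Y=1$ when $N=0$. The Meijer $G$-function is defined by the contour integral $$G^{m,n}_{p,q}\bigg(x\;\bigg|\;{a_1,\ldots,a_p\atop b_1,\ldots,b_q}\bigg)=\frac{1}{2\pi \mathrm{i}}\int_L\frac{\prod_{j=1}^m\Gamma(b_j-s)\prod_{j=1}^n\Gamma(1-a_j+s)}{\prod_{j=n+1}^p\Gamma(a_j-s)\prod_{j=m+1}^q\Gamma(1-b_j+s)}\,x^s\,\mathrm{d}s,$$ where the path $L$ separates the poles of the factors $\Gamma(b_j-s)$ from those of the factors $\Gamma(1-a_j+s)$, and empty products are $1$. For $x>0$ and the parameters used here, $L$ may be taken to be a vertical line $\mathrm{Re}\,s=c$ with $-\frac12<c<0$, traversed from $c-\mathrm{i}\infty$ to $c+\mathrm{i}\infty$ (for $N\ge 1$ or $M\geq 1$ as in the two cases). At $t=0$ the right-hand sides are understood as their limits as $t\to0$. *)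

theory Defs
  imports "HOL-Probability.Probability"
begin

text \<open>
  The integrand of \<open>G\<^sup>m\<^sup>,\<^sup>n\<^sub>p\<^sub>,\<^sub>q(x | a; b)\<close>, with \<open>p = length a\<close> and \<open>q = length b\<close>.  Lists are
  indexed from \<open>0\<close>, so \<open>a ! j\<close> is the parameter usually written with subscript \<open>j + 1\<close>.
  At a pole, \<open>Gamma\<close> takes the value \<open>0\<close>, so its reciprocal also is \<open>0\<close> there, as it should be.
\<close>

definition meijer_integrand ::
  "nat \<Rightarrow> nat \<Rightarrow> complex list \<Rightarrow> complex list \<Rightarrow> real \<Rightarrow> complex \<Rightarrow> complex" where
  "meijer_integrand m n a b x s =
     ((\<Prod>j<m. Gamma (b ! j - s)) * (\<Prod>j<n. Gamma (1 - a ! j + s))) /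
     ((\<Prod>j=n..<length a. Gamma (a ! j - s)) * (\<Prod>j=m..<length b. Gamma (1 - b ! j + s))) *
     complex_of_real x powr s"

text \<open>
  The contour is the line \<open>Re s = c\<close>, parametrised by \<open>s = c + \<i>y\<close> with \<open>y\<close> increasing over the
  reals; the factor \<open>\<i>\<close> under the integral sign is \<open>ds/dy\<close>.
\<close>

definition meijer_G ::
  "real \<Rightarrow> nat \<Rightarrow> nat \<Rightarrow> complex list \<Rightarrow> complex list \<Rightarrow> real \<Rightarrow> complex" where
  "meijer_G c m n a b x =
     1 / (2 * complex_of_real pi * \<i>) *
     (CLINT y|lborel. meijer_integrand m n a b x (Complex c y) * \<i>)"

text \<open>
  Existence of the contour integral.  It has to be recorded separately, because the Bochner
  integral of a non-integrable function is \<open>0\<close> by convention.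
\<close>

definition meijer_G_converges ::
  "real \<Rightarrow> nat \<Rightarrow> nat \<Rightarrow> complex list \<Rightarrow> complex list \<Rightarrow> real \<Rightarrow> bool" where
  "meijer_G_converges c m n a b x \<longleftrightarrow>
     complex_integrable lborel (\<lambda>y. meijer_integrand m n a b x (Complex c y) * \<i>)"

text \<open>
  The poles of \<open>Gamma (b ! j - s)\<close> are the points \<open>b ! j + k\<close>, those of \<open>Gamma (1 - a ! j + s)\<close>
  are the points \<open>a ! j - 1 - k\<close>, for natural numbers \<open>k\<close>.
\<close>

definition line_separates_poles ::
  "real \<Rightarrow> nat \<Rightarrow> nat \<Rightarrow> complex list \<Rightarrow> complex list \<Rightarrow> bool" where
  "line_separates_poles c m n a b \<longleftrightarrow>
     (\<forall>j<m. \<forall>k::nat. c < Re (b ! j + of_nat k)) \<and>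
     (\<forall>j<n. \<forall>k::nat. Re (a ! j - 1 - of_nat k) < c)"

lemma line_separates_poles_half:
  assumes "- 1 / 2 < c" "c < 0" "m \<le> Suc r" "n \<le> p"
  shows "line_separates_poles c m n (replicate p (1 / 2)) (0 # replicate r (1 / 2))"
  unfolding line_separates_poles_def
proof (intro conjI allI impI)
  fix j k :: nat
  assume "j < m"
  then have "0 \<le> Re ((0 # replicate r (1 / 2)) ! j :: complex)"
    using assms by (cases j) auto
  then show "c < Re ((0 # replicate r (1 / 2)) ! j + of_nat k)"
    using assms(2) by simp
next
  fix j k :: nat
  assume "j < n"
  then show "Re (replicate p (1 / 2) ! j - 1 - of_nat k) < c"
    using assms by simp
qed

end

theory Submission
  imports Defs
begin

text \<open>
  In the variable \<open>x = ln r\<close>, Euler's integral along the ray of argument \<open>\<theta>\<close> says that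
  \<open>Gamma (- s) exp (\<i> \<theta> s)\<close> is the Fourier transform of \<open>exp (- c x - e\<^sup>x cis \<theta>)\<close> on the line
  \<open>Re s = c < 0\<close>.  This bounds \<open>Gamma\<close> on vertical lines by \<open>C exp (- \<theta> |Im s|)\<close> for every
  \<open>\<theta> < \<pi>/2\<close>, and Fourier inversion represents \<open>exp (- v cis \<theta>)\<close>, hence
  \<open>(exp (- v cis \<theta>) + exp (- v cis (- \<theta>))) / 2\<close>, as an integral of \<open>Gamma (- s) cos (\<theta> s) v\<^sup>s\<close>.
  Putting \<open>v = |t Z|\<close>, taking expectations and letting \<open>\<theta> \<rightarrow> \<pi>/2\<close> yields, as \<open>Z\<close> is symmetric, the
  characteristic function of \<open>Z\<close> as an integral of \<open>Gamma (- s) cos (\<pi> s / 2) |t|\<^sup>s E |Z|\<^sup>s\<close>.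
  By independence \<open>E |Z|\<^sup>s\<close> is a product of Gaussian moments, which are values of \<open>Gamma\<close>.
  Replacing \<open>s\<close> by \<open>2 s\<close> and applying the duplication and reflection formulas gives both cases at
  once: for \<open>M = 0\<close> a factor \<open>Gamma (1/2 + s)\<close> is left in the denominator.
\<close>

section \<open>Fourier inversion\<close>

text \<open>Since \<open>K\<close> is bounded, a multiple of \<open>f x * g y\<close>, which is
  integrable on the product, dominates the double integrand. In both uses \<open>K\<close> is a
  phase of norm one: in the Gaussian regularisation below, and in the exchange of an expectation
  with a Mellin integral.\<close>

lemma (in pair_sigma_finite) Fubini_bounded_kernel:
  fixes f :: "'a \<Rightarrow> complex" and g :: "'b \<Rightarrow> complex" and K :: "'a \<Rightarrow> 'b \<Rightarrow> complex"
  assumes f: "integrable M1 f" and g: "integrable M2 g"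
    and K[measurable]: "case_prod K \<in> borel_measurable (M1 \<Otimes>\<^sub>M M2)"
    and B: "\<And>x y. norm (K x y) \<le> B"
  shows "(\<integral>y. g y * (\<integral>x. f x * K x y \<partial>M1) \<partial>M2) = (\<integral>x. f x * (\<integral>y. g y * K x y \<partial>M2) \<partial>M1)"
proof -
  have [measurable]: "f \<in> borel_measurable M1" "g \<in> borel_measurable M2"
    using f g by auto
  have fg: "integrable (M1 \<Otimes>\<^sub>M M2) (\<lambda>(x, y). f x * g y)"
  proof (rule Fubini_integrable)
    show "integrable M1 (\<lambda>x. \<integral>y. norm (case (x, y) of (x, y) \<Rightarrow> f x * g y) \<partial>M2)"
      using f by (simp add: norm_mult)
    show "AE x in M1. integrable M2 (\<lambda>y. case (x, y) of (x, y) \<Rightarrow> f x * g y)"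
      using g by simp
  qed measurable
  have "integrable (M1 \<Otimes>\<^sub>M M2) (\<lambda>(x, y). f x * g y * K x y)"
  proof (rule Bochner_Integration.integrable_bound)
    show "integrable (M1 \<Otimes>\<^sub>M M2) (\<lambda>p. of_real B * (case p of (x, y) \<Rightarrow> f x * g y))"
      using fg by simp
    show "AE p in M1 \<Otimes>\<^sub>M M2. norm (case p of (x, y) \<Rightarrow> f x * g y * K x y)
      \<le> norm (of_real B * (case p of (x, y) \<Rightarrow> f x * g y))"
    proof (intro AE_I2)
      fix p :: "'a \<times> 'b"
      have "norm (K (fst p) (snd p)) \<le> \<bar>B\<bar>" using B[of "fst p" "snd p"] by simp
      from mult_left_mono[OF this, of "norm (f (fst p) * g (snd p))"]
      show "norm (case p of (x, y) \<Rightarrow> f x * g y * K x y)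
          \<le> norm (of_real B * (case p of (x, y) \<Rightarrow> f x * g y))"
        by (simp add: norm_mult case_prod_beta mult_ac)
    qed
  qed measurable
  from Fubini_integral[OF this] have
    "(\<integral>y. (\<integral>x. f x * g y * K x y \<partial>M1) \<partial>M2) = (\<integral>x. (\<integral>y. f x * g y * K x y \<partial>M2) \<partial>M1)" .
  moreover have "(\<integral>x. f x * g y * K x y \<partial>M1) = g y * (\<integral>x. f x * K x y \<partial>M1)" for y
    by (subst integral_mult_right_zero[symmetric]) (simp add: mult_ac)
  moreover have "(\<integral>y. f x * g y * K x y \<partial>M2) = f x * (\<integral>y. g y * K x y \<partial>M2)" for x
    by (subst integral_mult_right_zero[symmetric]) (simp add: mult_ac)
  ultimately show ?thesis by simp
qed

lemma std_normal_fourier: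
  "(CLINT x|lborel. of_real (std_normal_density x) * iexp (t * x)) = of_real (exp (- t\<^sup>2 / 2))"
proof -
  have "(CLINT x|std_normal_distribution. iexp (t * x)) = of_real (exp (- t\<^sup>2 / 2))"
    using fun_cong[OF char_std_normal_distribution, of t] by (simp add: char_def)
  then show ?thesis
    by (subst (asm) integral_density) (auto simp: scaleR_conv_of_real)
qed

text \<open>Gaussian summation: the factor \<open>g n\<close> makes the double integral absolutely
  convergent, Fubini turns it into an average of \<open>f\<close> against a normal density of width
  \<open>\<epsilon> n\<close> about \<open>x\<close>, and \<open>\<epsilon> n\<close> tends to 0.
  Integrability of \<open>F\<close> dominates one limit; boundedness and continuity of
  \<open>f\<close> control the other.\<close>

lemma fourier_inversion:
  fixes f :: "real \<Rightarrow> complex"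
  assumes f: "integrable lborel f" and cont: "continuous_on UNIV f"
    and B: "\<And>x. norm (f x) \<le> B"
    and F: "integrable lborel F"
    and F_def: "\<And>y. F y = (CLINT x|lborel. f x * iexp (- (y * x)))"
  shows "(CLINT y|lborel. F y * iexp (y * x)) = 2 * of_real pi * f x"
proof -
  define \<epsilon> where "\<epsilon> n = inverse (real (Suc n))" for n
  have \<epsilon>: "\<epsilon> n > 0" for n by (simp add: \<epsilon>_def)
  have \<epsilon>0: "\<epsilon> \<longlonglongrightarrow> 0" unfolding \<epsilon>_def by (rule LIMSEQ_inverse_real_of_nat)
  define g where "g = (\<lambda>n y. complex_of_real (exp (- (\<epsilon> n * y)\<^sup>2 / 2)))"
  have [measurable]: "f \<in> borel_measurable borel" using f by auto
  have [measurable]: "F \<in> borel_measurable borel" using F by auto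
  have g_eq: "g n y = sqrt (2 * pi) * complex_of_real (std_normal_density (\<epsilon> n * y))" for n y
    by (simp add: g_def std_normal_density_def)
  have gauss: "integrable lborel (\<lambda>y. complex_of_real (std_normal_density y))"
    by (auto intro!: integrable_normal_density)
  have g_int: "integrable lborel (g n)" for n
    unfolding g_eq using lborel_integrable_real_affine[OF gauss, of "\<epsilon> n" 0] \<epsilon>[of n]
    by (intro integrable_mult_right) auto
  \<comment> \<open>Up to the factor \<open>2 * pi\<close>, the right side is the normal density in
    \<open>u\<close> with mean \<open>x\<close> and standard deviation \<open>\<epsilon> n\<close>.
    One \<open>sqrt (2 * pi)\<close> comes from \<open>g\<close>, the other from normalising the
    transformed Gaussian.\<close>
  have g_hat: "(CLINT y|lborel. g n y * iexp (x * y) * iexp (- (y * u))) =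
      of_real (2 * pi / \<epsilon> n) * of_real (std_normal_density ((u - x) / \<epsilon> n))" for n u
  proof -
    have a: "(CLINT y|lborel. of_real (std_normal_density y) * iexp ((x - u) / \<epsilon> n * y)) =
       of_real (\<epsilon> n) * (CLINT y|lborel. of_real (std_normal_density (\<epsilon> n * y)) * iexp ((x - u) * y))"
      using \<epsilon>[of n]
      by (subst lborel_integral_real_affine[where c="\<epsilon> n" and t=0]) (auto simp: scaleR_conv_of_real)
    have b: "(CLINT y|lborel. g n y * iexp (x * y) * iexp (- (y * u))) =
      sqrt (2 * pi) * (CLINT y|lborel. of_real (std_normal_density (\<epsilon> n * y)) * iexp ((x - u) * y))"
      unfolding g_eq
      by (subst integral_mult_right_zero[symmetric], intro Bochner_Integration.integral_cong refl)
         (simp add: mult.assoc exp_add[symmetric] algebra_simps)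
    have "of_real (\<epsilon> n) * (CLINT y|lborel. g n y * iexp (x * y) * iexp (- (y * u))) =
       complex_of_real (sqrt (2 * pi)) * (of_real (\<epsilon> n) *
         (CLINT y|lborel. of_real (std_normal_density (\<epsilon> n * y)) * iexp ((x - u) * y)))"
      unfolding b by (rule mult.left_commute)
    also have "\<dots> = complex_of_real (sqrt (2 * pi)) * of_real (exp (- ((x - u) / \<epsilon> n)\<^sup>2 / 2))"
      unfolding a[symmetric] std_normal_fourier ..
    also have "\<dots> = of_real (2 * pi) * of_real (std_normal_density ((u - x) / \<epsilon> n))"
      unfolding std_normal_density_def
      by (simp add: power2_commute power_divide field_simps flip: of_real_mult)
    finally show ?thesis using \<epsilon>[of n] by (simp add: field_simps)
  qed
  have id: "(CLINT y|lborel. F y * iexp (y * x) * g n y) =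
      2 * of_real pi * (CLINT z|lborel. of_real (std_normal_density z) * f (x + \<epsilon> n * z))" for n
  proof -
    have "(CLINT y|lborel. F y * iexp (y * x) * g n y) =
      (CLINT y|lborel. g n y * iexp (x * y) * (CLINT u|lborel. f u * iexp (- (y * u))))"
      by (simp add: F_def mult_ac)
    also have "\<dots> = (CLINT u|lborel. f u * (CLINT y|lborel. g n y * iexp (x * y) * iexp (- (y * u))))"
    proof (rule lborel_pair.Fubini_bounded_kernel)
      show "integrable lborel (\<lambda>y. g n y * iexp (x * y))"
        by (rule Bochner_Integration.integrable_bound[OF g_int[of n]])
           (auto simp: norm_mult g_def)
    qed (auto intro!: f)
    also have "\<dots> = (CLINT u|lborel. of_real (2 * pi / \<epsilon> n) * (f u * of_real (std_normal_density ((u - x) / \<epsilon> n))))"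
      unfolding g_hat by (simp add: mult_ac)
    also have "\<dots> = of_real (2 * pi / \<epsilon> n) * (CLINT u|lborel. f u * of_real (std_normal_density ((u - x) / \<epsilon> n)))"
      by (rule integral_mult_right_zero)
    \<comment> \<open>The substitution \<open>u = x + \<epsilon> n * z\<close> absorbs the factor
      \<open>1 / \<epsilon> n\<close> and moves the dependence on \<open>n\<close> into the argument
      of \<open>f\<close>.\<close>
    also have "\<dots> = of_real (2 * pi) * (CLINT z|lborel. f (x + \<epsilon> n * z) * of_real (std_normal_density z))"
      using \<epsilon>[of n]
      by (subst lborel_integral_real_affine[where c="\<epsilon> n" and t=x]) (auto simp: scaleR_conv_of_real)
    finally show ?thesis by (simp add: mult_ac)
  qed
  have lim: "(\<lambda>n. CLINT y|lborel. F y * iexp (y * x) * g n y) \<longlonglongrightarrow> (CLINT y|lborel. F y * iexp (y * x))"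
  proof (rule integral_dominated_convergence[where w="\<lambda>y. norm (F y)"])
    have "(\<lambda>n. F y * iexp (y * x) * g n y) \<longlonglongrightarrow> F y * iexp (y * x) * of_real (exp (- (0 * y)\<^sup>2 / 2))" for y
      unfolding g_def by (intro tendsto_intros \<epsilon>0) auto
    then show "AE y in lborel. (\<lambda>n. F y * iexp (y * x) * g n y) \<longlonglongrightarrow> F y * iexp (y * x)"
      by simp
    show "AE y in lborel. norm (F y * iexp (y * x) * g n y) \<le> norm (F y)" for n
      by (auto simp: norm_mult g_def intro!: mult_left_le)
    show "(\<lambda>y. F y * iexp (y * x) * g n y) \<in> borel_measurable lborel" for n
      unfolding g_def by measurable
  qed (use F in auto)
  have "(\<lambda>n. CLINT z|lborel. of_real (std_normal_density z) * f (x + \<epsilon> n * z)) \<longlonglongrightarrow>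
      (CLINT z|lborel. of_real (std_normal_density z) * f x)"
  proof (rule integral_dominated_convergence[where w="\<lambda>z. B * std_normal_density z"])
    show "AE z in lborel. (\<lambda>n. of_real (std_normal_density z) * f (x + \<epsilon> n * z))
        \<longlonglongrightarrow> of_real (std_normal_density z) * f x"
    proof (intro AE_I2 tendsto_intros)
      fix z
      have "(\<lambda>n. x + \<epsilon> n * z) \<longlonglongrightarrow> x + 0 * z" by (intro tendsto_intros \<epsilon>0)
      then show "(\<lambda>n. f (x + \<epsilon> n * z)) \<longlonglongrightarrow> f x"
        using cont by (intro continuous_on_tendsto_compose[OF cont]) auto
    qed
    show "AE z in lborel. norm (of_real (std_normal_density z) * f (x + \<epsilon> n * z)) \<le> B * std_normal_density z" for n
      using B by (auto simp: norm_mult mult.commute[of B] intro!: mult_left_mono)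
    show "(\<lambda>z. of_real (std_normal_density z) * f (x + \<epsilon> n * z)) \<in> borel_measurable lborel" for n
      by measurable
  qed (auto intro!: integrable_normal_density)
  from tendsto_mult_left[OF this, of "2 * of_real pi"]
  have "(CLINT y|lborel. F y * iexp (y * x)) =
      2 * of_real pi * (CLINT z|lborel. of_real (std_normal_density z) * f x)"
    using lim unfolding id by (intro LIMSEQ_unique)
  \<comment> \<open>The case \<open>t = 0\<close> of \<open>std_normal_fourier\<close> says that the
    normal density has total mass one.\<close>
  then show ?thesis
    using std_normal_fourier[of 0] by simp
qed

section \<open>Euler's integral on rotated rays\<close>

text \<open>The principal branch is discontinuous across the negative axis, so continuity in the
  plane does not give this. Along the real line itself \<open>Ln\<close> has constant imaginary part
  on each side of 0, namely 0 or \<open>pi\<close>, and \<open>0 powr z\<close> is \<open>0\<close>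
  by convention.\<close>

lemma borel_measurable_of_real_powr [measurable]:
  "(\<lambda>x. complex_of_real x powr z) \<in> borel_measurable borel"
proof -
  have neg: "Ln (of_real x) = of_real (ln (- x)) + \<i> * of_real pi" if "x < 0" for x
    using that by (intro Ln_unique) (auto simp: exp_add exp_of_real)
  have "(\<lambda>x. complex_of_real x powr z) = (\<lambda>x. if x = 0 then 0 else if x > 0
      then exp (z * of_real (ln x)) else exp (z * (of_real (ln (- x)) + \<i> * of_real pi)))"
    by (auto simp: fun_eq_iff powr_def Ln_of_real neg)
  also have "\<dots> \<in> borel_measurable borel" by measurable
  finally show ?thesis .
qed

text \<open>Euler's integral and the change of variables are stated for absolute integrability, that
  is, for the completed measure, while everything else here lives on \<open>lborel\<close>. For
  Borel functions the two agree.\<close>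

lemma absolutely_integrable_on_iff_has_bochner_integral_lborel:
  fixes h :: "'a::euclidean_space \<Rightarrow> 'b::euclidean_space"
  assumes [measurable]: "h \<in> borel_measurable borel" "S \<in> sets borel"
  shows "h absolutely_integrable_on S \<and> integral S h = I \<longleftrightarrow>
    has_bochner_integral lborel (\<lambda>x. indicator S x *\<^sub>R h x) I"
proof -
  have meas: "(\<lambda>x. indicator S x *\<^sub>R h x) \<in> borel_measurable lborel"
    by measurable
  have "h absolutely_integrable_on S \<Longrightarrow>
      integral S h = integral\<^sup>L lborel (\<lambda>x. indicator S x *\<^sub>R h x)"
    using set_lebesgue_integral_eq_integral(2)[of S h] integral_completion[OF meas]
    unfolding set_lebesgue_integral_def by simp
  moreover have "h absolutely_integrable_on S \<longleftrightarrow> integrable lborel (\<lambda>x. indicator S x *\<^sub>R h x)"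
    unfolding set_integrable_def by (rule integrable_completion[OF meas])
  ultimately show ?thesis
    unfolding has_bochner_integral_iff by auto
qed

text \<open>The substitution \<open>x = a * exp (b * u)\<close> turns Mellin integrals into Fourier
  integrals. It is read from left to right for Euler's integral, with \<open>a = b = 1\<close>, and
  from right to left for Gaussian moments, with \<open>b = 1 / 2\<close>.\<close>

lemma has_bochner_integral_exp_substitution:
  fixes f :: "real \<Rightarrow> complex"
  assumes [measurable]: "f \<in> borel_measurable borel" and "a > 0" "b > 0"
  shows "has_bochner_integral lborel (\<lambda>x. indicator {0<..} x *\<^sub>R f x) I \<longleftrightarrow>
    has_bochner_integral lborel (\<lambda>u. (a * b * exp (b * u)) *\<^sub>R f (a * exp (b * u))) I"
proof -
  let ?g = "\<lambda>u. a * exp (b * u)" and ?h = "\<lambda>u. a * b * exp (b * u)"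
  have range: "?g ` UNIV = {0<..}"
  proof (intro set_eqI iffI)
    fix x :: real assume x: "x \<in> {0<..}"
    then have "x = ?g (ln (x / a) / b)" using assms by simp
    then show "x \<in> ?g ` UNIV" by blast
  qed (use assms in auto)
  have S: "UNIV \<in> sets (lebesgue :: real measure)" by simp
  have der: "(?g has_field_derivative ?h u) (at u within UNIV)" for u
    by (auto intro!: derivative_eq_intros)
  have inj: "inj_on ?g UNIV" using assms by (auto simp: inj_on_def)
  have abs: "\<bar>?h u\<bar> = ?h u" for u using assms by simp
  have meas: "(\<lambda>u. ?h u *\<^sub>R f (?g u)) \<in> borel_measurable borel" by measurable
  show ?thesis
    using has_absolute_integral_change_of_variables_real[OF S der inj, of f I]
      absolutely_integrable_on_iff_has_bochner_integral_lborel[OF assms(1), of "{0<..}" I]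
      absolutely_integrable_on_iff_has_bochner_integral_lborel[OF meas, of UNIV I]
    unfolding range abs by simp
qed

lemma has_bochner_integral_Gamma_log:
  assumes z: "Re z > 0"
  shows "has_bochner_integral lborel (\<lambda>x. exp (z * of_real x - of_real (exp x))) (Gamma z)"
proof -
  let ?f = "\<lambda>r. complex_of_real r powr (z - 1) / of_real (exp r)"
  have "?f absolutely_integrable_on {0<..}"
    by (rule absolutely_integrable_Gamma_integral'[OF z])
  moreover have "integral {0<..} ?f = Gamma z"
    using Gamma_integral_complex'[OF z] by (rule integral_unique)
  moreover have "?f \<in> borel_measurable borel"
    by measurable
  ultimately have "has_bochner_integral lborel (\<lambda>x. indicator {0<..} x *\<^sub>R ?f x) (Gamma z)"
    using absolutely_integrable_on_iff_has_bochner_integral_lborel[of ?f "{0<..}" "Gamma z"] by simp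
  then have "has_bochner_integral lborel (\<lambda>u. exp u *\<^sub>R ?f (exp u)) (Gamma z)"
    by (subst (asm) has_bochner_integral_exp_substitution[where a=1 and b=1]) auto
  moreover have "exp u *\<^sub>R ?f (exp u) = exp (z * of_real u - of_real (exp u))" for u
    by (simp add: powr_def scaleR_conv_of_real Ln_of_real exp_diff algebra_simps flip: exp_of_real)
  ultimately show ?thesis by simp
qed

text \<open>Expanding \<open>exp (- u * exp x)\<close> in powers of \<open>u\<close> and integrating
  termwise gives values of \<open>Gamma\<close> at \<open>z + k\<close>, which are the coefficients
  of the binomial series of \<open>(1 + u) powr (- z)\<close>.\<close>

lemma has_bochner_integral_Gamma_log_disc:
  assumes z: "Re z > 0" and u: "norm u < 1"
  shows "has_bochner_integral lborel (\<lambda>x. exp (z * of_real x - of_real (exp x) * (1 + u)))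
    (Gamma z * (1 + u) powr (- z))"
proof -
  define f where "f k x = (- u) ^ k / fact k * exp ((z + of_nat k) * of_real x - of_real (exp x))" for k and x :: real
  have f: "has_bochner_integral lborel (f k) ((- u) ^ k / fact k * Gamma (z + of_nat k))" for k
    unfolding f_def using z by (intro has_bochner_integral_mult_right has_bochner_integral_Gamma_log) auto
  \<comment> \<open>A rising factorial of \<open>w\<close> is, up to sign and \<open>fact k\<close>,
    a binomial coefficient of \<open>- w\<close>. Both pairs \<open>(z, u)\<close> and
    \<open>(Re z, - norm u)\<close> are needed: the first for the sum, the second for the dominating
    series.\<close>
  have coeff: "(- v) ^ k / fact k * Gamma (w + of_nat k) = Gamma w * (((- w) gchoose k) * v ^ k)"
    if "Re w > 0" for v w :: complex and k
  proof -
    have "w \<notin> \<int>\<^sub>\<le>\<^sub>0" using that by (auto elim!: nonpos_Ints_cases)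
    then have "Gamma (w + of_nat k) = pochhammer w k * Gamma w"
      by (simp add: pochhammer_Gamma Gamma_eq_zero_iff)
    then show ?thesis
      by (simp add: gbinomial_pochhammer power_minus[of v] mult_ac)
  qed
  \<comment> \<open>Taking norms replaces \<open>z\<close> by \<open>Re z\<close> and
    \<open>u\<close> by \<open>- norm u\<close>, so the integrated norms are again terms of a
    binomial series, convergent because \<open>norm u < 1\<close>.\<close>
  have norm_f: "(\<integral>x. norm (f k x) \<partial>lborel) =
      Re (Gamma (of_real (Re z)) * (((- of_real (Re z)) gchoose k) * (- of_real (norm u)) ^ k))" for k
  proof -
    have "has_bochner_integral lborel
      (\<lambda>x. (of_real (norm u)) ^ k / fact k * exp ((of_real (Re z) + of_nat k) * of_real x - of_real (exp x)))
      (of_real (norm u) ^ k / fact k * Gamma (of_real (Re z) + of_nat k :: complex))"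
      using z by (intro has_bochner_integral_mult_right has_bochner_integral_Gamma_log) auto
    from has_bochner_integral_bounded_linear[OF bounded_linear_Re this]
    have "has_bochner_integral lborel (\<lambda>x. norm (f k x))
       (Re (of_real (norm u) ^ k / fact k * Gamma (of_real (Re z) + of_nat k :: complex)))"
    proof (rule has_bochner_integral_cong[THEN iffD1, rotated -1])
      fix x :: real
      have "(of_real (norm u)) ^ k / fact k * exp ((of_real (Re z) + of_nat k) * of_real x - of_real (exp x)) =
        complex_of_real (norm u ^ k / fact k * exp ((Re z + real k) * x - exp x))"
        by (simp flip: exp_of_real)
      then show "Re ((of_real (norm u)) ^ k / fact k * exp ((of_real (Re z) + of_nat k) * of_real x - of_real (exp x)))
        = norm (f k x)"
        by (simp only: Re_complex_of_real) (simp add: f_def norm_mult norm_power norm_divide)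
    qed auto
    then show ?thesis
      using coeff[of "of_real (Re z)" "- of_real (norm u)" k] z
      by (simp add: has_bochner_integral_iff)
  qed
  have summ: "summable (\<lambda>k. \<integral>x. norm (f k x) \<partial>lborel)"
  proof -
    have "summable (\<lambda>k. Gamma (of_real (Re z)) * (((- of_real (Re z)) gchoose k) * (- complex_of_real (norm u)) ^ k))"
      by (intro summable_mult sums_summable[OF gen_binomial_complex]) (use u in auto)
    then show ?thesis unfolding norm_f by (rule summable_Re)
  qed
  have ptw: "(\<lambda>k. f k x) sums exp (z * of_real x - of_real (exp x) * (1 + u))" for x
  proof -
    have "(\<lambda>k. exp (z * of_real x - of_real (exp x)) * ((- u * of_real (exp x)) ^ k /\<^sub>R fact k)) sums
      (exp (z * of_real x - of_real (exp x)) * exp (- u * of_real (exp x)))"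
      by (intro sums_mult exp_converges)
    moreover have "exp (z * of_real x - of_real (exp x)) * ((- u * of_real (exp x)) ^ k /\<^sub>R fact k) = f k x" for k
    proof -
      have "complex_of_real (exp x) ^ k = exp (of_nat k * of_real x)"
        by (simp add: exp_of_real exp_of_nat_mult)
      then show ?thesis
        unfolding f_def mult_minus_left[symmetric] power_mult_distrib
        by (simp add: scaleR_conv_of_real exp_add exp_diff field_simps)
    qed
    moreover have "exp (z * of_real x - of_real (exp x)) * exp (- u * of_real (exp x)) =
       exp (z * of_real x - of_real (exp x) * (1 + u))"
      by (simp add: exp_add[symmetric] algebra_simps)
    ultimately show ?thesis by simp
  qed
  have norm_ptw: "summable (\<lambda>k. norm (f k x))" for x
  proof -
    have "summable (\<lambda>k. exp (Re z * x - exp x) * ((norm u * exp x) ^ k /\<^sub>R fact k))"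
      by (intro summable_mult sums_summable[OF exp_converges])
    moreover have "exp (Re z * x - exp x) * ((norm u * exp x) ^ k /\<^sub>R fact k) = norm (f k x)" for k
      unfolding f_def
      by (simp add: norm_mult norm_divide norm_power power_mult_distrib exp_add exp_diff exp_of_nat_mult field_simps)
    ultimately show ?thesis by (simp only:)
  qed
  have int: "integrable lborel (f k)" for k using f by (simp add: has_bochner_integral_iff)
  have AE: "AE x in lborel. summable (\<lambda>k. norm (f k x))" using norm_ptw by simp
  have "(\<lambda>x. \<Sum>k. f k x) = (\<lambda>x. exp (z * of_real x - of_real (exp x) * (1 + u)))"
    using ptw by (auto simp: sums_iff)
  with integrable_suminf[OF int AE summ] sums_integral[OF int AE summ]
  have "integrable lborel (\<lambda>x. exp (z * of_real x - of_real (exp x) * (1 + u)))"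
    "(\<lambda>k. integral\<^sup>L lborel (f k)) sums (CLINT x|lborel. exp (z * of_real x - of_real (exp x) * (1 + u)))"
    by simp_all
  moreover have "integral\<^sup>L lborel (f k) = Gamma z * (((- z) gchoose k) * u ^ k)" for k
    using f coeff[OF z, of u k] by (simp add: has_bochner_integral_iff)
  moreover have "(\<lambda>k. Gamma z * (((- z) gchoose k) * u ^ k)) sums (Gamma z * (1 + u) powr (- z))"
    by (intro sums_mult gen_binomial_complex u)
  ultimately show ?thesis
    using sums_unique2 by (simp add: has_bochner_integral_iff)
qed

text \<open>The unit disc about 1 meets every ray of argument strictly between
  \<open>- pi / 2\<close> and \<open>pi / 2\<close>, so the disc formula together with a positive
  rescaling reaches all these angles. At \<open>pi / 2\<close> itself the integrand has norm
  \<open>exp (Re z * x)\<close> and absolute convergence is lost.\<close>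

lemma has_bochner_integral_Gamma_rotated:
  assumes z: "Re z > 0" and \<theta>: "\<bar>\<theta>\<bar> < pi / 2"
  shows "has_bochner_integral lborel (\<lambda>x. exp (z * of_real x - of_real (exp x) * cis \<theta>))
    (Gamma z * exp (- (\<i> * of_real \<theta> * z)))"
proof -
  have cos: "cos \<theta> > 0" using \<theta> by (intro cos_gt_zero_pi) auto
  \<comment> \<open>\<open>1 + u\<close> is the point of the ray of argument \<open>\<theta>\<close> closest to \<open>1\<close>; it lies in the disc of the
    previous lemma, and a translation of \<open>x\<close> rescales it to \<open>cis \<theta>\<close>.\<close>
  define u where "u = cos \<theta> * cis \<theta> - 1"
  have u: "1 + u = cos \<theta> * cis \<theta>" by (simp add: u_def)
  have "u = \<i> * sin \<theta> * cis \<theta>"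
    by (simp add: u_def complex_eq_iff sin_squared_eq power2_eq_square[symmetric])
  then have "norm u = \<bar>sin \<theta>\<bar>" by (simp add: norm_mult)
  moreover have "\<bar>sin \<theta>\<bar>\<^sup>2 < 1" using cos sin_cos_squared_add[of \<theta>] by (simp add: sin_squared_eq)
  ultimately have norm_u: "norm u < 1" by (simp add: abs_square_less_1)
  \<comment> \<open>The bound on \<theta> keeps it within the principal branch, so that
    \<open>powr\<close> can be expanded explicitly.\<close>
  have "Ln (of_real (cos \<theta>) * exp (\<i> * of_real \<theta>)) = of_real (ln (cos \<theta>)) + \<i> * of_real \<theta>"
    using cos \<theta> by (intro Ln_unique) (auto simp: exp_add exp_of_real)
  then have ln: "Ln (1 + u) = of_real (ln (cos \<theta>)) + \<i> * of_real \<theta>"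
    by (simp add: u cis_conv_exp)
  have "1 + u \<noteq> 0" using cos by (simp add: u)
  from has_bochner_integral_Gamma_log_disc[OF z norm_u]
  have "has_bochner_integral lborel
    (\<lambda>x. exp (z * of_real (- ln (cos \<theta>) + x) - of_real (exp (- ln (cos \<theta>) + x)) * (1 + u)))
    (Gamma z * (1 + u) powr (- z))"
    by (subst (asm) lborel_has_bochner_integral_real_affine_iff[where c=1 and t="- ln (cos \<theta>)"]) auto
  from has_bochner_integral_mult_right[OF this, of "exp (z * of_real (ln (cos \<theta>)))"]
  have "has_bochner_integral lborel
    (\<lambda>x. exp (z * of_real (ln (cos \<theta>))) * exp (z * of_real (- ln (cos \<theta>) + x) - of_real (exp (- ln (cos \<theta>) + x)) * (1 + u)))
    (exp (z * of_real (ln (cos \<theta>))) * (Gamma z * (1 + u) powr (- z)))" .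
  moreover have "exp (z * of_real (ln (cos \<theta>))) * exp (z * of_real (- ln (cos \<theta>) + x) - of_real (exp (- ln (cos \<theta>) + x)) * (1 + u))
     = exp (z * of_real x - of_real (exp x) * cis \<theta>)" for x
  proof -
    have "of_real (exp (- ln (cos \<theta>) + x)) * (1 + u) = of_real (exp x) * cis \<theta>"
      using cos by (simp add: u exp_diff exp_add exp_minus field_simps)
    then show ?thesis by (simp only: exp_add[symmetric]) (simp add: algebra_simps)
  qed
  moreover have "exp (z * of_real (ln (cos \<theta>))) * (Gamma z * (1 + u) powr (- z)) = Gamma z * exp (- (\<i> * of_real \<theta> * z))"
    using \<open>1 + u \<noteq> 0\<close>
    by (simp add: powr_def ln mult.left_commute[of _ "Gamma z"] exp_add[symmetric] algebra_simps)
  ultimately show ?thesis by simp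
qed

text \<open>In the rotated integral the norm of the integrand depends neither on \<open>y\<close>
  nor on the sign of the angle, whereas the factor multiplying \<open>Gamma\<close> has norm
  \<open>exp (\<theta>' * y)\<close>. Giving the angle the sign of \<open>y\<close> yields the
  bound.\<close>

lemma Gamma_decay:
  assumes a: "a > 0" and \<theta>: "0 \<le> \<theta>" "\<theta> < pi / 2"
  shows "\<exists>C\<ge>0. \<forall>y. norm (Gamma (Complex a y)) \<le> C * exp (- (\<theta> * \<bar>y\<bar>))"
proof -
  define C where "C = (\<integral>x. exp (a * x - exp x * cos \<theta>) \<partial>lborel)"
  have "norm (Gamma (Complex a y)) * exp (\<theta>' * y) \<le> C" if "\<bar>\<theta>'\<bar> = \<theta>" for \<theta>' y
  proof -
    have "has_bochner_integral lborel (\<lambda>x. exp (Complex a y * of_real x - of_real (exp x) * cis \<theta>'))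
      (Gamma (Complex a y) * exp (- (\<i> * of_real \<theta>' * Complex a y)))"
      using a \<theta> that by (intro has_bochner_integral_Gamma_rotated) auto
    then have "norm (Gamma (Complex a y) * exp (- (\<i> * of_real \<theta>' * Complex a y))) \<le>
      (\<integral>x. norm (exp (Complex a y * of_real x - of_real (exp x) * cis \<theta>')) \<partial>lborel)"
      by (simp only: has_bochner_integral_iff) (metis integral_norm_bound)
    also have "\<dots> = C"
      using that by (auto simp: C_def abs_if split: if_splits)
    finally show ?thesis by (simp add: norm_mult)
  qed
  note * = this
  have "norm (Gamma (Complex a y)) \<le> C * exp (- (\<theta> * \<bar>y\<bar>))" for y
    using *[of \<theta> y] *[of "- \<theta>" y] \<theta>(1) by (cases "y \<ge> 0") (auto simp: exp_minus field_simps)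
  moreover have "C \<ge> 0" unfolding C_def by (rule integral_nonneg_AE) auto
  ultimately show ?thesis by blast
qed

lemma integrable_exp_neg_abs:
  fixes k :: real
  assumes "k > 0"
  shows "integrable lborel (\<lambda>y. exp (- (k * \<bar>y\<bar>)))"
proof -
  have "(\<lambda>y. exp (- k * y)) absolutely_integrable_on {0..}"
    using integrable_on_exp_minus_to_infinity[OF assms, of 0]
    by (intro nonnegative_absolutely_integrable_1) auto
  then have "integrable lborel (\<lambda>y. indicator {0..} y *\<^sub>R exp (- k * y))"
    unfolding set_integrable_def by (subst (asm) integrable_completion) auto
  then have "integrable lborel (\<lambda>y. indicator {0..} y *\<^sub>R exp (- (k * \<bar>y\<bar>)))"
    by (rule Bochner_Integration.integrable_cong[THEN iffD1, rotated -1]) (auto simp: indicator_def)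
  then show ?thesis
    using has_bochner_integral_even_function[OF has_bochner_integral_integrable, of "\<lambda>y. exp (- (k * \<bar>y\<bar>))"]
    by (auto simp: has_bochner_integral_iff)
qed

lemma continuous_on_Gamma_vertical_line:
  assumes "c < 0"
  shows "continuous_on UNIV (\<lambda>y. Gamma (- Complex c y))"
proof -
  have "- (of_real c + \<i> * of_real y) \<notin> \<int>\<^sub>\<le>\<^sub>0" for y
    using assms by (auto elim!: nonpos_Ints_cases simp: complex_eq_iff)
  then show ?thesis
    unfolding Complex_eq by (intro continuous_at_imp_continuous_on ballI isCont_Gamma continuous_intros) auto
qed

section \<open>Mellin--Barnes integrals for characteristic functions\<close>

text \<open>By the rotated Euler integral at \<open>z = - s\<close>, \<open>?F\<close> is the
  Fourier transform of \<open>f\<close>. Inversion is applied at \<open>x = ln v\<close>, where the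
  factor \<open>v powr c\<close> cancels \<open>exp (- c * x)\<close>.\<close>

lemma exp_minus_mellin_inversion:
  assumes c: "c < 0" and \<theta>: "\<bar>\<theta>\<bar> < pi / 2" and v: "v > 0"
  shows "integrable lborel (\<lambda>y. Gamma (- Complex c y) * exp (\<i> * of_real \<theta> * Complex c y))" (is "integrable _ ?F")
    and "(CLINT y|lborel. Gamma (- Complex c y) * exp (\<i> * of_real \<theta> * Complex c y) * of_real v powr Complex c y)
      = 2 * of_real pi * exp (- (of_real v * cis \<theta>))"
proof -
  define f where "f x = exp (- (of_real (c * x)) - of_real (exp x) * cis \<theta>)" for x
  have cos: "cos \<theta> > 0" using \<theta> by (intro cos_gt_zero_pi) auto
  have ft: "has_bochner_integral lborel (\<lambda>x. f x * iexp (- (y * x))) (?F y)" for y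
  proof -
    have "has_bochner_integral lborel (\<lambda>x. exp (- Complex c y * of_real x - of_real (exp x) * cis \<theta>))
      (Gamma (- Complex c y) * exp (- (\<i> * of_real \<theta> * - Complex c y)))"
      using c \<theta> by (intro has_bochner_integral_Gamma_rotated) auto
    moreover have "exp (- Complex c y * of_real x - of_real (exp x) * cis \<theta>) = f x * iexp (- (y * x))" for x
      unfolding f_def exp_add[symmetric] by (simp add: Complex_eq algebra_simps)
    ultimately show ?thesis by simp
  qed
  have f_int: "integrable lborel f"
    using ft[of 0] by (simp add: has_bochner_integral_iff)
  have f_cont: "continuous_on UNIV f" unfolding f_def by (intro continuous_intros)
  \<comment> \<open>The exponent \<open>- c * x - exp x * cos \<theta>\<close> of the norm is
    maximal where its derivative vanishes, at \<open>x0 = ln (- c / cos \<theta>)\<close>. The bound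
    is the value there, and the tangent inequality for \<open>exp\<close> at \<open>x0\<close>
    proves it.\<close>
  have f_bound: "norm (f x) \<le> exp (- c * (ln (- c / cos \<theta>) - 1))" for x
  proof -
    define x0 where "x0 = ln (- c / cos \<theta>)"
    have "exp x0 * cos \<theta> = - c" using c cos by (simp add: x0_def divide_neg_pos)
    then have "exp x * cos \<theta> = - c * exp (x - x0)" 
      by (metis exp_diff mult.commute nonzero_mult_div_cancel_left exp_not_eq_zero times_divide_eq_right)
    also have "\<dots> \<ge> - c * (1 + (x - x0))"
      using c exp_ge_add_one_self[of "x - x0"] by (intro mult_left_mono) auto
    finally show ?thesis unfolding f_def x0_def by (simp add: algebra_simps)
  qed
  show F_int: "integrable lborel ?F"
  proof -
    \<comment> \<open>An angle strictly between \<open>\<bar>\<theta>\<bar>\<close> and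
      \<open>pi / 2\<close>: the decay of \<open>Gamma\<close> at rate \<open>\<theta>'\<close>
      beats the growth of the rotation factor at rate \<open>\<bar>\<theta>\<bar>\<close>.\<close>
    define \<theta>' where "\<theta>' = (\<bar>\<theta>\<bar> + pi / 2) / 2"
    have \<theta>': "0 \<le> \<theta>'" "\<theta>' < pi / 2" "\<bar>\<theta>\<bar> < \<theta>'" using \<theta> by (auto simp: \<theta>'_def)
    from Gamma_decay[of "- c", OF _ \<theta>'(1,2)] c obtain C where C: "C \<ge> 0"
      "\<And>y. norm (Gamma (Complex (- c) y)) \<le> C * exp (- (\<theta>' * \<bar>y\<bar>))" by auto
    show ?thesis
    proof (rule Bochner_Integration.integrable_bound)
      show "integrable lborel (\<lambda>y. C * exp (- ((\<theta>' - \<bar>\<theta>\<bar>) * \<bar>y\<bar>)))"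
        using \<theta>' by (intro integrable_mult_right integrable_exp_neg_abs) auto
      have "continuous_on UNIV ?F"
        using c by (intro continuous_on_mult continuous_on_Gamma_vertical_line)
          (auto simp: Complex_eq intro!: continuous_intros)
      then show "?F \<in> borel_measurable lborel" by (simp add: borel_measurable_continuous_onI)
      show "AE y in lborel. norm (?F y) \<le> norm (C * exp (- ((\<theta>' - \<bar>\<theta>\<bar>) * \<bar>y\<bar>)))"
      proof (intro AE_I2)
        fix y
        have "norm (?F y) = norm (Gamma (Complex (- c) (- y))) * exp (- (\<theta> * y))"
          by (simp add: norm_mult complex_minus)
        also have "\<dots> \<le> (C * exp (- (\<theta>' * \<bar>y\<bar>))) * exp (\<bar>\<theta>\<bar> * \<bar>y\<bar>)"
        proof (intro mult_mono)
          have "- (\<theta> * y) \<le> \<bar>\<theta>\<bar> * \<bar>y\<bar>" by (simp add: abs_mult[symmetric])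
          then show "exp (- (\<theta> * y)) \<le> exp (\<bar>\<theta>\<bar> * \<bar>y\<bar>)" by simp
        qed (use C C(2)[of "- y"] in auto)
        also have "\<dots> = norm (C * exp (- ((\<theta>' - \<bar>\<theta>\<bar>) * \<bar>y\<bar>)))"
          using C(1) by (simp add: algebra_simps exp_add[symmetric])
        finally show "norm (?F y) \<le> norm (C * exp (- ((\<theta>' - \<bar>\<theta>\<bar>) * \<bar>y\<bar>)))" .
      qed
    qed
  qed
  have inv: "(CLINT y|lborel. ?F y * iexp (y * ln v)) = 2 * of_real pi * f (ln v)"
    by (rule fourier_inversion[OF f_int f_cont f_bound F_int])
       (use ft in \<open>simp add: has_bochner_integral_iff\<close>)
  have powr: "?F y * of_real v powr Complex c y = of_real (exp (c * ln v)) * (?F y * iexp (y * ln v))" for y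
    using v by (simp add: powr_def Ln_of_real Complex_eq exp_of_real[symmetric] exp_add[symmetric] algebra_simps)
  have f_ln: "of_real (exp (c * ln v)) * f (ln v) = exp (- (of_real v * cis \<theta>))"
    using v unfolding f_def by (simp add: exp_of_real[symmetric] exp_add[symmetric])
  have "(CLINT y|lborel. ?F y * of_real v powr Complex c y) =
      of_real (exp (c * ln v)) * (CLINT y|lborel. ?F y * iexp (y * ln v))"
    unfolding powr by (rule integral_mult_right_zero)
  also have "\<dots> = 2 * of_real pi * (of_real (exp (c * ln v)) * f (ln v))"
    unfolding inv by (rule mult.left_commute)
  finally show "(CLINT y|lborel. ?F y * of_real v powr Complex c y) = 2 * of_real pi * exp (- (of_real v * cis \<theta>))"
    unfolding f_ln .
qed

lemma norm_cos_le_exp_abs_Im: "norm (cos z) \<le> exp \<bar>Im z\<bar>" for z :: complex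
proof -
  have "norm (cos z) = norm (exp (\<i> * z) + exp (- (\<i> * z))) / 2"
    by (simp add: cos_exp_eq norm_divide)
  also have "\<dots> \<le> (exp (- Im z) + exp (Im z)) / 2"
    using norm_triangle_ineq[of "exp (\<i> * z)" "exp (- (\<i> * z))"] by simp
  also have "\<dots> \<le> (exp \<bar>Im z\<bar> + exp \<bar>Im z\<bar>) / 2"
    by (intro divide_right_mono add_mono) auto
  finally show ?thesis by simp
qed

text \<open>Modulus and phase of the power. Base 0 is covered, since both sides are then
  \<open>0\<close>; hence it rewrites powers of \<open>\<bar>Z \<omega>\<bar>\<close> at every
  \<omega>, without removing a null set.\<close>

lemma of_real_powr_Complex:
  assumes "r \<ge> 0"
  shows "of_real r powr Complex c y = of_real (r powr c) * iexp (y * ln r)"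
  using assms
  by (cases "r = 0")
     (auto simp: powr_def Ln_of_real Complex_eq exp_add[symmetric] algebra_simps simp flip: exp_of_real)

text \<open>Averaging over \<theta> and its negative makes the exponential kernel a cosine. As
  \<theta> tends to \<open>pi / 2\<close>, the averaged exponentials tend to \<open>cos v\<close>,
  the part of the phase that a symmetric variable sees.\<close>

lemma mellin_inversion_cos:
  assumes c: "c < 0" and \<theta>: "\<bar>\<theta>\<bar> < pi / 2" and v: "v > 0"
  shows "integrable lborel (\<lambda>y. Gamma (- Complex c y) * cos (of_real \<theta> * Complex c y))" (is "integrable _ ?F")
    and "(CLINT y|lborel. Gamma (- Complex c y) * cos (of_real \<theta> * Complex c y) * of_real v powr Complex c y)
      = of_real pi * (exp (- (of_real v * cis \<theta>)) + exp (- (of_real v * cis (- \<theta>))))"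
proof -
  let ?G = "\<lambda>\<theta> y. Gamma (- Complex c y) * exp (\<i> * of_real \<theta> * Complex c y)"
  have \<theta>': "\<bar>- \<theta>\<bar> < pi / 2" using \<theta> by simp
  note 1 = exp_minus_mellin_inversion[OF c \<theta> v] and 2 = exp_minus_mellin_inversion[OF c \<theta>' v]
  have F: "?F y = (?G \<theta> y + ?G (- \<theta>) y) / 2" for y
    by (simp add: cos_exp_eq algebra_simps add_divide_distrib)
  show "integrable lborel ?F"
    unfolding F using 1(1) 2(1) by (intro integrable_divide Bochner_Integration.integrable_add)
  have int: "integrable lborel (\<lambda>y. ?G \<theta>' y * of_real v powr Complex c y)" if "\<bar>\<theta>'\<bar> < pi / 2" for \<theta>'
  proof (rule Bochner_Integration.integrable_bound)
    show "integrable lborel (\<lambda>y. of_real (v powr c) * ?G \<theta>' y)"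
      using exp_minus_mellin_inversion(1)[OF c that v] by (intro integrable_mult_right)
    have [measurable]: "?G \<theta>' \<in> borel_measurable borel"
      using exp_minus_mellin_inversion(1)[OF c that v] by auto
    show "(\<lambda>y. ?G \<theta>' y * of_real v powr Complex c y) \<in> borel_measurable lborel"
      using v by (simp only: of_real_powr_Complex less_imp_le) measurable
    show "AE y in lborel. norm (?G \<theta>' y * of_real v powr Complex c y) \<le> norm (of_real (v powr c) * ?G \<theta>' y)"
      using v by (auto simp: of_real_powr_Complex norm_mult mult_ac)
  qed
  have "(CLINT y|lborel. ?F y * of_real v powr Complex c y) =
     (CLINT y|lborel. (?G \<theta> y * of_real v powr Complex c y + ?G (- \<theta>) y * of_real v powr Complex c y) / 2)"
    unfolding F by (intro Bochner_Integration.integral_cong refl) (simp add: field_simps)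
  also have "\<dots> = of_real pi * (exp (- (of_real v * cis \<theta>)) + exp (- (of_real v * cis (- \<theta>))))"
    using int[OF \<theta>] int[OF \<theta>'] 1(2) 2(2)
    by (simp add: Bochner_Integration.integral_add distrib_left)
  finally show "(CLINT y|lborel. ?F y * of_real v powr Complex c y)
      = of_real pi * (exp (- (of_real v * cis \<theta>)) + exp (- (of_real v * cis (- \<theta>))))" .
qed

text \<open>
  At \<open>\<theta> = \<pi>/2\<close> the inversion formula for the cosine converges only conditionally.  It is therefore
  integrated over \<open>Z\<close> for \<open>\<theta> < \<pi>/2\<close>; once the Mellin transform \<open>m\<close> of \<open>|Z|\<close> stands under the
  integral, it supplies the decay needed to let \<open>\<theta> \<rightarrow> \<pi>/2\<close>.
\<close>

lemma (in prob_space) char_mellin_barnes: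
  fixes Z :: "'a \<Rightarrow> real"
  assumes Z[measurable]: "random_variable borel Z"
    and sym: "distr M borel (\<lambda>\<omega>. - Z \<omega>) = distr M borel Z"
    and nz: "AE \<omega> in M. Z \<omega> \<noteq> 0"
    and c: "c < 0"
    and mom: "\<And>y. has_bochner_integral M (\<lambda>\<omega>. of_real \<bar>Z \<omega>\<bar> powr Complex c y) (m y)"
    and m: "integrable lborel (\<lambda>y. norm (Gamma (- Complex c y)) * exp (pi / 2 * \<bar>y\<bar>) * norm (m y))"
    and t: "t \<noteq> 0"
  defines "J \<equiv> \<lambda>y. Gamma (- Complex c y) * cos (of_real (pi / 2) * Complex c y) * of_real \<bar>t\<bar> powr Complex c y * m y"
  shows "integrable lborel J" and "integral\<^sup>L lborel J = 2 * of_real pi * char (distr M borel Z) t"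
proof -
  define \<theta> where "\<theta> n = pi / 2 - inverse (real (Suc n))" for n
  have \<theta>_bounds: "0 \<le> \<theta> n" "\<theta> n < pi / 2" for n
  proof -
    have "inverse (real (Suc n)) \<le> 1" by (simp add: inverse_le_1_iff)
    then show "0 \<le> \<theta> n" "\<theta> n < pi / 2" using pi_gt3 by (auto simp: \<theta>_def)
  qed
  have \<theta>_lim: "\<theta> \<longlonglongrightarrow> pi / 2"
    unfolding \<theta>_def using tendsto_diff[OF tendsto_const LIMSEQ_inverse_real_of_nat, of "pi / 2"] by simp
  define g where "g \<theta> y = Gamma (- Complex c y) * cos (of_real \<theta> * Complex c y)" for \<theta> y
  define h where "h \<theta> \<omega> = (exp (- (of_real \<bar>t * Z \<omega>\<bar> * cis \<theta>)) + exp (- (of_real \<bar>t * Z \<omega>\<bar> * cis (- \<theta>)))) / 2" for \<theta> \<omega>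
  interpret pair_sigma_finite M "lborel :: real measure" ..
  have mom_eq: "m y = (CLINT \<omega>|M. of_real (\<bar>Z \<omega>\<bar> powr c) * iexp (y * ln \<bar>Z \<omega>\<bar>))" for y
    using mom[of y] by (simp add: of_real_powr_Complex has_bochner_integral_iff)
  have [measurable]: "m \<in> borel_measurable lborel"
    unfolding mom_eq by measurable
  have [measurable]: "(\<lambda>y. Gamma (- Complex c y)) \<in> borel_measurable lborel"
    using continuous_on_Gamma_vertical_line[OF c] by (simp add: borel_measurable_continuous_onI)
  have [measurable]: "(\<lambda>y. Complex c y) \<in> borel_measurable borel"
    unfolding Complex_eq by measurable
  have [measurable]: "(\<lambda>y. cos (of_real \<theta> * Complex c y)) \<in> borel_measurable borel" for \<theta> :: real
    unfolding Complex_eq by (intro borel_measurable_continuous_onI continuous_intros)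
  have [measurable]: "(\<lambda>y. of_real \<bar>t\<bar> powr Complex c y) \<in> borel_measurable borel"
    by (simp add: of_real_powr_Complex) measurable
  have key: "(CLINT y|lborel. g (\<theta> n) y * of_real \<bar>t\<bar> powr Complex c y * m y) = 2 * of_real pi * expectation (h (\<theta> n))" for n
  proof -
    have \<theta>n: "\<bar>\<theta> n\<bar> < pi / 2" using \<theta>_bounds[of n] by simp
    have "(CLINT y|lborel. g (\<theta> n) y * of_real \<bar>t\<bar> powr Complex c y * m y) =
      (CLINT y|lborel. g (\<theta> n) y * of_real \<bar>t\<bar> powr Complex c y *
         (CLINT \<omega>|M. of_real (\<bar>Z \<omega>\<bar> powr c) * iexp (y * ln \<bar>Z \<omega>\<bar>)))"
      by (simp only: mom_eq)
    also have "\<dots> = (CLINT \<omega>|M. of_real (\<bar>Z \<omega>\<bar> powr c) *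
       (CLINT y|lborel. g (\<theta> n) y * of_real \<bar>t\<bar> powr Complex c y * iexp (y * ln \<bar>Z \<omega>\<bar>)))"
    proof (rule Fubini_bounded_kernel)
      show "integrable M (\<lambda>\<omega>. complex_of_real (\<bar>Z \<omega>\<bar> powr c))"
        using mom[of 0] by (simp add: of_real_powr_Complex has_bochner_integral_iff)
      show "integrable lborel (\<lambda>y. g (\<theta> n) y * of_real \<bar>t\<bar> powr Complex c y)"
      proof (rule Bochner_Integration.integrable_bound)
        show "integrable lborel (\<lambda>y. of_real (\<bar>t\<bar> powr c) * g (\<theta> n) y)"
          unfolding g_def by (intro integrable_mult_right mellin_inversion_cos(1)[OF c \<theta>n zero_less_one])
        show "(\<lambda>y. g (\<theta> n) y * of_real \<bar>t\<bar> powr Complex c y) \<in> borel_measurable lborel"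
          unfolding g_def by measurable
        show "AE y in lborel. norm (g (\<theta> n) y * of_real \<bar>t\<bar> powr Complex c y) \<le> norm (of_real (\<bar>t\<bar> powr c) * g (\<theta> n) y)"
          by (auto simp: of_real_powr_Complex norm_mult)
      qed
      show "norm (iexp (y * ln \<bar>Z \<omega>\<bar>)) \<le> 1" for \<omega> y by simp
    qed measurable
    also have "\<dots> = (CLINT \<omega>|M. 2 * of_real pi * h (\<theta> n) \<omega>)"
    proof (rule integral_cong_AE)
      show "AE \<omega> in M. of_real (\<bar>Z \<omega>\<bar> powr c) *
         (CLINT y|lborel. g (\<theta> n) y * of_real \<bar>t\<bar> powr Complex c y * iexp (y * ln \<bar>Z \<omega>\<bar>)) = 2 * of_real pi * h (\<theta> n) \<omega>"
        using nz
      proof eventually_elim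
        fix \<omega> assume "Z \<omega> \<noteq> 0"
        with t have pos: "\<bar>t * Z \<omega>\<bar> > 0" by simp
        have "of_real (\<bar>Z \<omega>\<bar> powr c) * (g (\<theta> n) y * of_real \<bar>t\<bar> powr Complex c y * iexp (y * ln \<bar>Z \<omega>\<bar>))
            = g (\<theta> n) y * of_real \<bar>t * Z \<omega>\<bar> powr Complex c y" for y
          using powr_times_real[of "of_real \<bar>t\<bar>" "of_real \<bar>Z \<omega>\<bar>" "Complex c y"]
          by (simp add: abs_mult of_real_powr_Complex[of "\<bar>Z \<omega>\<bar>"] mult_ac)
        then have "of_real (\<bar>Z \<omega>\<bar> powr c) *
         (CLINT y|lborel. g (\<theta> n) y * of_real \<bar>t\<bar> powr Complex c y * iexp (y * ln \<bar>Z \<omega>\<bar>)) =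
           (CLINT y|lborel. g (\<theta> n) y * of_real \<bar>t * Z \<omega>\<bar> powr Complex c y)"
          by (simp only: integral_mult_right_zero[symmetric])
        also have "\<dots> = 2 * of_real pi * h (\<theta> n) \<omega>"
          unfolding g_def mellin_inversion_cos(2)[OF c \<theta>n pos] h_def by simp
        finally show "of_real (\<bar>Z \<omega>\<bar> powr c) *
         (CLINT y|lborel. g (\<theta> n) y * of_real \<bar>t\<bar> powr Complex c y * iexp (y * ln \<bar>Z \<omega>\<bar>)) = 2 * of_real pi * h (\<theta> n) \<omega>" .
      qed
      show "(\<lambda>\<omega>. of_real (\<bar>Z \<omega>\<bar> powr c) *
         (CLINT y|lborel. g (\<theta> n) y * of_real \<bar>t\<bar> powr Complex c y * iexp (y * ln \<bar>Z \<omega>\<bar>))) \<in> borel_measurable M"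
        unfolding g_def by measurable
      show "(\<lambda>\<omega>. 2 * of_real pi * h (\<theta> n) \<omega>) \<in> borel_measurable M"
        unfolding h_def by measurable
    qed
    also have "\<dots> = 2 * of_real pi * expectation (h (\<theta> n))"
      by (rule integral_mult_right_zero)
    finally show ?thesis .
  qed
  have J_eq: "J y = g (pi / 2) y * of_real \<bar>t\<bar> powr Complex c y * m y" for y
    by (simp add: J_def g_def)
  \<comment> \<open>One majorant for all angles in the closed interval from 0 to
    \<open>pi / 2\<close>: it gives integrability of \<open>J\<close> at the endpoint as well as the
    passage to the limit.\<close>
  let ?w = "\<lambda>y. \<bar>t\<bar> powr c * (norm (Gamma (- Complex c y)) * exp (pi / 2 * \<bar>y\<bar>) * norm (m y))"
  have w_int: "integrable lborel ?w" using m by (rule integrable_mult_right)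
  have dom: "norm (g \<theta> y * of_real \<bar>t\<bar> powr Complex c y * m y) \<le> ?w y" if "0 \<le> \<theta>" "\<theta> \<le> pi / 2" for \<theta> y
  proof -
    have "norm (cos (of_real \<theta> * Complex c y)) \<le> exp \<bar>\<theta> * y\<bar>"
      using norm_cos_le_exp_abs_Im[of "of_real \<theta> * Complex c y"] by simp
    also have "\<dots> \<le> exp (pi / 2 * \<bar>y\<bar>)"
      using that mult_right_mono[OF that(2), of "\<bar>y\<bar>"] by (simp add: abs_mult)
    finally have "norm (cos (of_real \<theta> * Complex c y)) \<le> exp (pi / 2 * \<bar>y\<bar>)" .
    then have "\<bar>t\<bar> powr c * (norm (Gamma (- Complex c y)) * norm (cos (of_real \<theta> * Complex c y)) * norm (m y)) \<le> ?w y"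
      by (intro mult_left_mono mult_right_mono) auto
    then show ?thesis
      by (simp add: g_def norm_mult of_real_powr_Complex mult_ac)
  qed
  have g_lim: "(\<lambda>n. g (\<theta> n) y) \<longlonglongrightarrow> g (pi / 2) y" for y
    unfolding g_def by (intro tendsto_intros \<theta>_lim)
  have meas: "(\<lambda>y. g \<theta> y * of_real \<bar>t\<bar> powr Complex c y * m y) \<in> borel_measurable lborel" for \<theta>
    unfolding g_def by measurable
  have "J \<in> borel_measurable lborel" unfolding J_eq[abs_def] by (rule meas)
  then show "integrable lborel J"
    using dom[of "pi / 2"] J_eq
    by (intro Bochner_Integration.integrable_bound[OF w_int]) (auto intro!: order_trans[OF _ abs_ge_self])
  have lim1: "(\<lambda>n. CLINT y|lborel. g (\<theta> n) y * of_real \<bar>t\<bar> powr Complex c y * m y) \<longlonglongrightarrow> integral\<^sup>L lborel J"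
    unfolding J_eq[abs_def]
  proof (rule integral_dominated_convergence[OF meas meas w_int])
    show "AE y in lborel. (\<lambda>n. g (\<theta> n) y * of_real \<bar>t\<bar> powr Complex c y * m y)
        \<longlonglongrightarrow> g (pi / 2) y * of_real \<bar>t\<bar> powr Complex c y * m y"
      by (intro AE_I2 tendsto_intros g_lim)
    show "AE y in lborel. norm (g (\<theta> n) y * of_real \<bar>t\<bar> powr Complex c y * m y) \<le> ?w y" for n
      using \<theta>_bounds[of n] by (intro AE_I2 dom) auto
  qed
  have "norm (h \<theta> \<omega>) \<le> 1" if "0 \<le> \<theta>" "\<theta> \<le> pi / 2" for \<theta> \<omega>
  proof -
    have "cos \<theta> \<ge> 0" using that by (intro cos_ge_zero) auto
    then have "norm (exp (- (of_real \<bar>t * Z \<omega>\<bar> * cis \<theta>))) \<le> 1" "norm (exp (- (of_real \<bar>t * Z \<omega>\<bar> * cis (- \<theta>)))) \<le> 1"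
      by simp_all
    from norm_triangle_mono[OF this] show ?thesis
      unfolding h_def norm_divide norm_numeral by linarith
  qed
  moreover have "(\<lambda>n. h (\<theta> n) \<omega>) \<longlonglongrightarrow> h (pi / 2) \<omega>" for \<omega>
    unfolding h_def cis_conv_exp by (intro tendsto_intros \<theta>_lim) auto
  moreover have "h \<theta> \<in> borel_measurable M" for \<theta> unfolding h_def by measurable
  ultimately have lim2: "(\<lambda>n. expectation (h (\<theta> n))) \<longlonglongrightarrow> expectation (h (pi / 2))"
    using \<theta>_bounds by (intro integral_dominated_convergence[where w="\<lambda>_. 1"]) (auto simp: less_imp_le)
  have h_cos: "h (pi / 2) \<omega> = (iexp (t * Z \<omega>) + iexp (t * - Z \<omega>)) / 2" for \<omega>
  proof -
    have "cis (- (pi / 2)) = - \<i>" by (simp add: complex_eq_iff)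
    then show ?thesis by (cases "t * Z \<omega> \<ge> 0") (simp_all add: h_def abs_if mult.commute add.commute)
  qed
  have char1: "char (distr M borel Z) t = expectation (\<lambda>\<omega>. iexp (t * Z \<omega>))"
    unfolding char_def by (subst integral_distr) auto
  have char2: "char (distr M borel Z) t = expectation (\<lambda>\<omega>. iexp (t * - Z \<omega>))"
    unfolding char_def sym[symmetric] by (subst integral_distr) auto
  have int1: "integrable M (\<lambda>\<omega>. iexp (t * Z \<omega>))" and int2: "integrable M (\<lambda>\<omega>. iexp (t * - Z \<omega>))"
    by (intro integrable_const_bound[where B=1] AE_I2; simp)+
  have "expectation (h (pi / 2)) =
      (expectation (\<lambda>\<omega>. iexp (t * Z \<omega>)) + expectation (\<lambda>\<omega>. iexp (t * - Z \<omega>))) / 2"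
    unfolding h_cos using Bochner_Integration.integral_add[OF int1 int2] by (simp only: integral_divide_zero)
  also have "\<dots> = char (distr M borel Z) t"
    unfolding char1[symmetric] char2[symmetric] by simp
  finally have "(\<lambda>n. 2 * of_real pi * expectation (h (\<theta> n))) \<longlonglongrightarrow> 2 * of_real pi * char (distr M borel Z) t"
    using tendsto_mult_left[OF lim2, of "2 * of_real pi"] by simp
  with lim1 show "integral\<^sup>L lborel J = 2 * of_real pi * char (distr M borel Z) t"
    unfolding key by (rule LIMSEQ_unique)
qed

section \<open>Products of independent symmetric factors\<close>

lemma of_real_abs_prod_powr:
  "of_real \<bar>\<Prod>k\<in>K. f k\<bar> powr z = (\<Prod>k\<in>K. of_real \<bar>f k\<bar> powr z)" for f :: "'i \<Rightarrow> real" and z :: complex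
proof (induction K rule: infinite_finite_induct)
  case (insert k K)
  then show ?case
    using powr_times_real[of "of_real \<bar>f k\<bar>" "of_real \<bar>\<Prod>k\<in>K. f k\<bar>" z] by (simp add: abs_mult)
qed auto

text \<open>One symmetric factor suffices. The sign is moved onto \<open>U k\<close>, which is
  independent of the product \<open>V\<close> of the other factors; the joint law of the pair is a
  product measure and so does not change, nor does its image under multiplication.\<close>

lemma (in prob_space) distr_uminus_prod:
  fixes U :: "'i \<Rightarrow> 'a \<Rightarrow> real"
  assumes K: "finite K" "k \<in> K" and indep: "indep_vars (\<lambda>_. borel) U K"
    and sym: "distr M borel (\<lambda>\<omega>. - U k \<omega>) = distr M borel (U k)"
  shows "distr M borel (\<lambda>\<omega>. - (\<Prod>k\<in>K. U k \<omega>)) = distr M borel (\<lambda>\<omega>. \<Prod>k\<in>K. U k \<omega>)"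
proof -
  define V where "V \<omega> = (\<Prod>i\<in>K - {k}. U i \<omega>)" for \<omega>
  have ind: "indep_var borel (U k) borel V"
    unfolding V_def using indep_vars_prod[of "K - {k}" k U] K indep by (simp add: insert_absorb)
  have ind': "indep_var borel (\<lambda>\<omega>. - U k \<omega>) borel V"
    using indep_var_compose[OF ind, of uminus borel id borel] by (simp add: comp_def)
  have [measurable]: "random_variable borel (U k)" "random_variable borel V"
    using ind by (auto dest: indep_var_rv1 indep_var_rv2)
  have prod: "(\<Prod>k\<in>K. U k \<omega>) = U k \<omega> * V \<omega>" for \<omega>
    unfolding V_def using K by (simp add: prod.remove)
  have "distr M (borel \<Otimes>\<^sub>M borel) (\<lambda>\<omega>. (- U k \<omega>, V \<omega>)) = distr M (borel \<Otimes>\<^sub>M borel) (\<lambda>\<omega>. (U k \<omega>, V \<omega>))"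
    using ind ind' sym unfolding indep_var_distribution_eq by metis
  then have "distr (distr M (borel \<Otimes>\<^sub>M borel) (\<lambda>\<omega>. (- U k \<omega>, V \<omega>))) borel (\<lambda>(x, y). x * y) =
    distr (distr M (borel \<Otimes>\<^sub>M borel) (\<lambda>\<omega>. (U k \<omega>, V \<omega>))) borel (\<lambda>(x, y). x * y)"
    by simp
  then show ?thesis
    unfolding prod by (subst (asm) (1 2) distr_distr) (auto simp: comp_def)
qed

text \<open>Independence makes the Mellin transform of the product the product of the individual
  ones. The decay of these has to compensate \<open>cos\<close>, which grows at the rate
  \<open>pi / 2\<close> that \<open>Gamma\<close> does not quite reach in
  \<open>Gamma_decay\<close>; since \<open>K\<close> is nonempty, there is at least one decaying
  factor.\<close>

lemma (in prob_space) char_prod_mellin_barnes: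
  fixes U :: "'i \<Rightarrow> 'a \<Rightarrow> real"
  assumes K: "finite K" "K \<noteq> {}" and indep: "indep_vars (\<lambda>_. borel) U K"
    and sym: "\<And>k. k \<in> K \<Longrightarrow> distr M borel (\<lambda>\<omega>. - U k \<omega>) = distr M borel (U k)"
    and nz: "\<And>k. k \<in> K \<Longrightarrow> AE \<omega> in M. U k \<omega> \<noteq> 0"
    and c: "c < 0"
    and mom: "\<And>k y. k \<in> K \<Longrightarrow> has_bochner_integral M (\<lambda>\<omega>. of_real \<bar>U k \<omega>\<bar> powr Complex c y) (m k y)"
    and \<delta>: "0 < \<delta>" "\<delta> < pi / 2"
    and decay: "\<And>k. k \<in> K \<Longrightarrow> \<exists>C. \<forall>y. norm (m k y) \<le> C * exp (- (\<delta> * \<bar>y\<bar>))"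
    and t: "t \<noteq> 0"
  defines "J \<equiv> \<lambda>y. Gamma (- Complex c y) * cos (of_real (pi / 2) * Complex c y) * of_real \<bar>t\<bar> powr Complex c y *
      (\<Prod>k\<in>K. m k y)"
  shows "integrable lborel J"
    and "integral\<^sup>L lborel J = 2 * of_real pi * char (distr M borel (\<lambda>\<omega>. \<Prod>k\<in>K. U k \<omega>)) t"
proof -
  let ?Z = "\<lambda>\<omega>. \<Prod>k\<in>K. U k \<omega>"
  have U_meas: "U k \<in> borel_measurable M" if "k \<in> K" for k
    using indep that by (auto simp: indep_vars_def)
  have Z_meas: "?Z \<in> borel_measurable M" using U_meas by measurable
  have "AE \<omega> in M. \<forall>k\<in>K. U k \<omega> \<noteq> 0" using K(1) nz by (simp add: AE_finite_all)
  then have Z_nz: "AE \<omega> in M. ?Z \<omega> \<noteq> 0" by eventually_elim (simp add: K(1))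
  have Z_sym: "distr M borel (\<lambda>\<omega>. - ?Z \<omega>) = distr M borel ?Z"
    using K indep sym distr_uminus_prod by (metis ex_in_conv)
  have Z_mom: "has_bochner_integral M (\<lambda>\<omega>. of_real \<bar>?Z \<omega>\<bar> powr Complex c y) (\<Prod>k\<in>K. m k y)" for y
  proof -
    have ind: "indep_vars (\<lambda>_. borel) (\<lambda>k \<omega>. of_real \<bar>U k \<omega>\<bar> powr Complex c y) K"
      by (rule indep_vars_compose2[OF indep]) measurable
    have int: "integrable M (\<lambda>\<omega>. of_real \<bar>U k \<omega>\<bar> powr Complex c y)" if "k \<in> K" for k
      using mom[OF that] by (simp add: has_bochner_integral_iff)
    show ?thesis
      unfolding of_real_abs_prod_powr has_bochner_integral_iff
      using indep_vars_integrable[OF K(1) ind int] indep_vars_lebesgue_integral[OF K(1) ind int] mom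
      by (simp add: has_bochner_integral_iff)
  qed
  have [measurable]: "(\<lambda>y. Gamma (- Complex c y)) \<in> borel_measurable lborel"
    using continuous_on_Gamma_vertical_line[OF c] by (simp add: borel_measurable_continuous_onI)
  have [measurable]: "(\<lambda>y. \<Prod>k\<in>K. m k y) \<in> borel_measurable lborel"
  proof -
    have "(\<Prod>k\<in>K. m k y) = (CLINT \<omega>|M. of_real (\<bar>?Z \<omega>\<bar> powr c) * iexp (y * ln \<bar>?Z \<omega>\<bar>))" for y
      using Z_mom[of y] by (simp add: of_real_powr_Complex has_bochner_integral_iff)
    then show ?thesis using Z_meas by simp
  qed
  have "integrable lborel (\<lambda>y. norm (Gamma (- Complex c y)) * exp (pi / 2 * \<bar>y\<bar>) * norm (\<Prod>k\<in>K. m k y))"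
  proof -
    from decay obtain C where C: "norm (m k y) \<le> C k * exp (- (\<delta> * \<bar>y\<bar>))" if "k \<in> K" for k y
      by metis
    have C_nonneg: "0 \<le> C k" if "k \<in> K" for k using order_trans[OF norm_ge_zero C[OF that, of 0]] by simp
    have m_bound: "norm (\<Prod>k\<in>K. m k y) \<le> (\<Prod>k\<in>K. C k) * exp (- (\<delta> * \<bar>y\<bar>))" for y
    proof -
      have "norm (\<Prod>k\<in>K. m k y) \<le> (\<Prod>k\<in>K. C k * exp (- (\<delta> * \<bar>y\<bar>)))"
        unfolding prod_norm[symmetric] using C by (intro prod_mono) auto
      also have "\<dots> = (\<Prod>k\<in>K. C k) * exp (- (\<delta> * \<bar>y\<bar>)) ^ card K"
        by (simp add: prod.distrib)
      \<comment> \<open>As the exponential is at most 1 and \<open>card K\<close> is at least 1, all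
        but one of its powers may be dropped.\<close>
      also have "\<dots> \<le> (\<Prod>k\<in>K. C k) * exp (- (\<delta> * \<bar>y\<bar>)) ^ 1"
        using K \<delta> C_nonneg by (intro mult_left_mono power_decreasing prod_nonneg) (auto simp: Suc_le_eq card_gt_0_iff)
      finally show ?thesis by simp
    qed
    \<comment> \<open>\<open>Gamma\<close> falls short of the growth rate \<open>pi / 2\<close> by
      \<open>\<delta> / 2\<close>, the moments contribute \<open>\<delta>\<close>, and net decay at
      rate \<open>\<delta> / 2\<close> remains.\<close>
    from Gamma_decay[of "- c" "pi / 2 - \<delta> / 2"] c \<delta> obtain D where D: "D \<ge> 0"
      "\<And>y. norm (Gamma (Complex (- c) y)) \<le> D * exp (- ((pi / 2 - \<delta> / 2) * \<bar>y\<bar>))" by auto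
    show ?thesis
    proof (rule Bochner_Integration.integrable_bound)
      show "integrable lborel (\<lambda>y. D * (\<Prod>k\<in>K. C k) * exp (- (\<delta> / 2 * \<bar>y\<bar>)))"
        using \<delta> by (intro integrable_mult_right integrable_exp_neg_abs) auto
      show "AE y in lborel. norm (norm (Gamma (- Complex c y)) * exp (pi / 2 * \<bar>y\<bar>) * norm (\<Prod>k\<in>K. m k y))
          \<le> norm (D * (\<Prod>k\<in>K. C k) * exp (- (\<delta> / 2 * \<bar>y\<bar>)))"
      proof (intro AE_I2)
        fix y
        have "norm (Gamma (- Complex c y)) * exp (pi / 2 * \<bar>y\<bar>) * norm (\<Prod>k\<in>K. m k y) \<le>
          D * exp (- ((pi / 2 - \<delta> / 2) * \<bar>y\<bar>)) * exp (pi / 2 * \<bar>y\<bar>) * ((\<Prod>k\<in>K. C k) * exp (- (\<delta> * \<bar>y\<bar>)))"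
          using D(1) D(2)[of "- y"] m_bound[of y] by (intro mult_mono) (auto simp: complex_minus)
        also have "\<dots> = D * (\<Prod>k\<in>K. C k) *
           (exp (- ((pi / 2 - \<delta> / 2) * \<bar>y\<bar>)) * exp (pi / 2 * \<bar>y\<bar>) * exp (- (\<delta> * \<bar>y\<bar>)))"
          by (simp only: mult_ac)
        also have "\<dots> = D * (\<Prod>k\<in>K. C k) * exp (- (\<delta> / 2 * \<bar>y\<bar>))"
          unfolding exp_add[symmetric] by (simp add: algebra_simps)
        also have "\<dots> \<le> norm (D * (\<Prod>k\<in>K. C k) * exp (- (\<delta> / 2 * \<bar>y\<bar>)))" by simp
        finally show "norm (norm (Gamma (- Complex c y)) * exp (pi / 2 * \<bar>y\<bar>) * norm (\<Prod>k\<in>K. m k y))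
          \<le> norm (D * (\<Prod>k\<in>K. C k) * exp (- (\<delta> / 2 * \<bar>y\<bar>)))" by simp
      qed
    qed measurable
  qed
  from char_mellin_barnes[OF Z_meas Z_sym Z_nz c Z_mom this t]
  show "integrable lborel J"
    and "integral\<^sup>L lborel J = 2 * of_real pi * char (distr M borel ?Z) t"
    unfolding J_def .
qed

section \<open>Absolute moments, symmetry and nonvanishing of centred normal variables\<close>

text \<open>The substitution \<open>x = \<sigma> * sqrt 2 * exp (u / 2)\<close> turns
  \<open>x^2 / (2 * \<sigma>^2)\<close> into \<open>exp u\<close>, so the integral over the positive
  half-line becomes the logarithmic Euler integral at \<open>(s + 1) / 2\<close>; evenness doubles
  it. The condition on \<open>s\<close> says that this argument has positive real part.\<close>

lemma has_bochner_integral_abs_powr_normal: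
  assumes "\<sigma> > 0" and s: "Re s > - 1"
  shows "has_bochner_integral lborel (\<lambda>x. normal_density 0 \<sigma> x *\<^sub>R of_real \<bar>x\<bar> powr s)
    (of_real (\<sigma> * sqrt 2) powr s * Gamma ((s + 1) / 2) / of_real (sqrt pi))"
proof -
  define a where "a = \<sigma> * sqrt 2"
  have a: "a > 0" using assms by (simp add: a_def)
  let ?f = "\<lambda>x. normal_density 0 \<sigma> x *\<^sub>R complex_of_real \<bar>x\<bar> powr s"
  let ?I = "of_real a powr s * Gamma ((s + 1) / 2) / of_real (sqrt pi)"
  have meas[measurable]: "?f \<in> borel_measurable borel"
    using measurable_compose[OF borel_measurable_abs borel_measurable_of_real_powr[of s]] by measurable
  have "has_bochner_integral lborel (\<lambda>u. of_real a powr s / (2 * of_real (sqrt pi)) * exp ((s + 1) / 2 * of_real u - of_real (exp u)))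
      (of_real a powr s / (2 * of_real (sqrt pi)) * Gamma ((s + 1) / 2))"
    using s by (intro has_bochner_integral_mult_right has_bochner_integral_Gamma_log) auto
  moreover have "of_real a powr s / (2 * of_real (sqrt pi)) * exp ((s + 1) / 2 * of_real u - of_real (exp u)) =
     (a * (1 / 2) * exp (1 / 2 * u)) *\<^sub>R ?f (a * exp (1 / 2 * u))" for u
  proof -
    have "(a * exp (1 / 2 * u))\<^sup>2 / (2 * \<sigma>\<^sup>2) = exp u"
      using assms by (simp add: a_def power_mult_distrib exp_double[symmetric])
    then have nd: "normal_density 0 \<sigma> (a * exp (1 / 2 * u)) = exp (- exp u) / (a * sqrt pi)"
      using assms by (simp add: normal_density_def real_sqrt_mult a_def)
    have pw: "of_real \<bar>a * exp (1 / 2 * u)\<bar> powr s = of_real a powr s * exp (s / 2 * of_real u)"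
    proof -
      have "Ln (of_real (a * exp (1 / 2 * u))) = of_real (ln a + u / 2)"
        using a by (subst Ln_of_real) (auto simp: ln_mult)
      moreover have "\<bar>a * exp (1 / 2 * u)\<bar> = a * exp (1 / 2 * u)" using a by simp
      ultimately have "of_real \<bar>a * exp (1 / 2 * u)\<bar> powr s = exp (s * of_real (ln a + u / 2))"
        using a by (simp only: powr_def) simp
      also have "\<dots> = of_real a powr s * exp (s / 2 * of_real u)"
        using a by (simp add: powr_def Ln_of_real exp_add[symmetric] algebra_simps)
      finally show ?thesis .
    qed
    have re: "a * (1 / 2) * exp (1 / 2 * u) * (exp (- exp u) / (a * sqrt pi)) =
        exp (u / 2) * exp (- exp u) / (2 * sqrt pi)"
      using a by simp
    have "exp ((s + 1) / 2 * of_real u - of_real (exp u)) =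
        exp (s / 2 * of_real u) * of_real (exp (u / 2) * exp (- exp u))"
      unfolding of_real_mult exp_of_real[symmetric] exp_add[symmetric] by (simp add: field_simps exp_of_real)
    then show ?thesis
      by (simp only: nd pw scaleR_scaleR re) (simp add: scaleR_conv_of_real)
  qed
  ultimately have "has_bochner_integral lborel (\<lambda>x. indicator {0<..} x *\<^sub>R ?f x)
     (of_real a powr s / (2 * of_real (sqrt pi)) * Gamma ((s + 1) / 2))"
    using has_bochner_integral_exp_substitution[OF meas a, of "1 / 2"] by simp
  \<comment> \<open>The endpoint is harmless even pointwise: \<open>0 powr s\<close> is
    \<open>0\<close>.\<close>
  moreover have "indicator {0<..} x *\<^sub>R ?f x = indicator {0..} x *\<^sub>R ?f x" for x
    by (cases "x = 0") (auto simp: indicator_def)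
  ultimately have "has_bochner_integral lborel (\<lambda>x. indicator {0..} x *\<^sub>R ?f x)
     (of_real a powr s / (2 * of_real (sqrt pi)) * Gamma ((s + 1) / 2))"
    by (simp only:)
  from has_bochner_integral_even_function[OF this] show ?thesis
    by (simp add: normal_density_def a_def scaleR_conv_of_real)
qed

lemma (in prob_space) normal_abs_powr_moment:
  assumes X: "distributed M lborel X (normal_density 0 \<sigma>)" and \<sigma>: "\<sigma> > 0" and s: "Re s > - 1"
  shows "has_bochner_integral M (\<lambda>\<omega>. of_real \<bar>X \<omega>\<bar> powr s)
    (of_real (\<sigma> * sqrt 2) powr s * Gamma ((s + 1) / 2) / of_real (sqrt pi))"
proof -
  have [measurable]: "X \<in> borel_measurable M" using distributed_measurable[OF X] by simp
  have [measurable]: "(\<lambda>x::real. complex_of_real \<bar>x\<bar> powr s) \<in> borel_measurable borel"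
    using measurable_compose[OF borel_measurable_abs borel_measurable_of_real_powr[of s]] by measurable
  have "has_bochner_integral (density lborel (\<lambda>x. ennreal (normal_density 0 \<sigma> x))) (\<lambda>x. of_real \<bar>x\<bar> powr s)
    (of_real (\<sigma> * sqrt 2) powr s * Gamma ((s + 1) / 2) / of_real (sqrt pi))"
    using has_bochner_integral_abs_powr_normal[OF \<sigma> s] by (intro has_bochner_integral_density) auto
  then have "has_bochner_integral (distr M lborel X) (\<lambda>x. of_real \<bar>x\<bar> powr s)
    (of_real (\<sigma> * sqrt 2) powr s * Gamma ((s + 1) / 2) / of_real (sqrt pi))"
    using distributed_distr_eq_density[OF X] by simp
  then show ?thesis
    unfolding has_bochner_integral_iff by (subst (asm) integrable_distr_eq, measurable) (simp add: integral_distr)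
qed

lemma (in prob_space) normal_AE_nonzero:
  assumes X: "distributed M lborel X (normal_density 0 \<sigma>)"
  shows "AE \<omega> in M. X \<omega> \<noteq> 0"
proof -
  have [measurable]: "X \<in> borel_measurable M" using distributed_measurable[OF X] by simp
  have "AE x in lborel. x \<noteq> (0::real)" by (rule AE_lborel_singleton)
  then have "AE x in density lborel (\<lambda>x. ennreal (normal_density 0 \<sigma> x)). x \<noteq> 0"
    by (subst AE_density) auto
  then have "AE x in distr M lborel X. x \<noteq> 0"
    unfolding distributed_distr_eq_density[OF X] .
  then show ?thesis by (subst (asm) AE_distr_iff) auto
qed

lemma (in prob_space) normal_distr_uminus:
  assumes X: "distributed M lborel X (normal_density 0 \<sigma>)" and \<sigma>: "\<sigma> > 0"
  shows "distr M borel (\<lambda>\<omega>. - X \<omega>) = distr M borel X"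
proof -
  have "distributed M lborel (\<lambda>\<omega>. - X \<omega>) (normal_density 0 \<sigma>)"
    using normal_density_affine[OF X \<sigma>, of "- 1" 0] by simp
  from distributed_distr_eq_density[OF this] distributed_distr_eq_density[OF X]
  have "distr M lborel (\<lambda>\<omega>. - X \<omega>) = distr M lborel X" by simp
  then show ?thesis by (simp cong: distr_cong)
qed

section \<open>Assembling the integrand: powers of nonnegative bases and Gamma identities\<close>

lemma Gamma_nonzero_Re_pos: "Re z > 0 \<Longrightarrow> Gamma z \<noteq> 0" for z :: complex
  by (auto simp: Gamma_eq_zero_iff elim!: nonpos_Ints_cases)

lemma of_real_powr_double:
  "of_real r powr (2 * s) = of_real (r\<^sup>2) powr s" if "r > 0" for s :: complex
  using that by (simp add: powr_def Ln_of_real ln_realpow mult_ac flip: of_real_power)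

lemma of_real_mult_powr:
  fixes z :: complex
  assumes "0 \<le> a" "0 \<le> b"
  shows "of_real (a * b) powr z = of_real a powr z * of_real b powr z"
  using powr_times_real[of "of_real a" "of_real b" z] assms by simp

lemma of_real_prod_powr:
  fixes f :: "'i \<Rightarrow> real" and z :: complex
  assumes "\<And>k. k \<in> K \<Longrightarrow> 0 \<le> f k"
  shows "of_real (\<Prod>k\<in>K. f k) powr z = (\<Prod>k\<in>K. of_real (f k) powr z)"
proof -
  have "\<bar>\<Prod>k\<in>K. f k\<bar> = (\<Prod>k\<in>K. f k)" using assms by (simp add: prod_nonneg)
  moreover have "(\<Prod>k\<in>K. of_real \<bar>f k\<bar> powr z) = (\<Prod>k\<in>K. of_real (f k) powr z)"
    using assms by (intro prod.cong) auto
  ultimately show ?thesis using of_real_abs_prod_powr[of f K z] by simp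
qed

text \<open>Serves to read moments of \<open>1 / Y\<close> as moments of \<open>Y\<close> at
  \<open>- s\<close>. At \<open>r = 0\<close> both sides are \<open>0\<close>, because
  \<open>inverse 0\<close> is \<open>0\<close>.\<close>

lemma of_real_abs_inverse_powr:
  "of_real \<bar>inverse r\<bar> powr s = of_real \<bar>r\<bar> powr (- s)" for s :: complex
proof (cases "r = 0")
  case False
  then have "Ln (of_real \<bar>inverse r\<bar>) = - of_real (ln \<bar>r\<bar>)" "Ln (of_real \<bar>r\<bar>) = of_real (ln \<bar>r\<bar>)"
    by (subst Ln_of_real; simp add: ln_inverse)+
  with False show ?thesis by (simp only: powr_def) simp
qed simp

text \<open>Duplication splits \<open>Gamma (- (2 * s))\<close> into
  \<open>Gamma (- s) * Gamma (1 / 2 - s)\<close>, and reflection writes the cosine with the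
  reciprocal of \<open>Gamma (1 / 2 - s) * Gamma (1 / 2 + s)\<close>; the common factor cancels. The
  power of \<open>1 / 4\<close> left by duplication accounts for the extra \<open>2^2\<close> in the
  denominator of the argument \<open>x\<close>.\<close>

lemma Gamma_mellin_barnes_kernel:
  assumes c: "- 1 / 2 < Re s" "Re s < 0"
  shows "2 * of_real (sqrt pi) * (Gamma (- (2 * s)) * cos (of_real pi * s)) =
    of_real pi * Gamma (- s) / Gamma (1 / 2 + s) * of_real (1 / 4) powr s"
proof -
  have poles: "- s \<notin> \<int>\<^sub>\<le>\<^sub>0" "1 / 2 - s \<notin> \<int>\<^sub>\<le>\<^sub>0" "1 / 2 + s \<notin> \<int>\<^sub>\<le>\<^sub>0"
    using c by (auto elim!: nonpos_Ints_cases simp: complex_eq_iff)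
  have nz: "Gamma (1 / 2 - s) \<noteq> 0" "Gamma (1 / 2 + s) \<noteq> 0"
    using c by (auto intro!: Gamma_nonzero_Re_pos)
  have four: "of_real (1 / 4) powr s = exp (- (2 * s * of_real (ln 2)))"
  proof -
    have "ln (1 / 4 :: real) = - (2 * ln 2)"
      using ln_realpow[of 2 2] by (simp add: ln_div)
    then have "Ln (of_real (1 / 4)) = - (2 * of_real (ln 2))"
      by (subst Ln_of_real) auto
    then show ?thesis by (simp add: powr_def mult_ac)
  qed
  have dup: "2 * of_real (sqrt pi) * Gamma (- (2 * s)) = Gamma (- s) * Gamma (1 / 2 - s) * of_real (1 / 4) powr s"
  proof -
    have s: "- s + 1 / 2 = 1 / 2 - s" "2 * - s = - (2 * s)" by simp_all
    have "Gamma (- s) * Gamma (1 / 2 - s) * of_real (1 / 4) powr s =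
        exp ((1 - - (2 * s)) * of_real (ln 2)) * of_real (sqrt pi) * Gamma (- (2 * s)) * of_real (1 / 4) powr s"
      using Gamma_legendre_duplication[of "- s", unfolded s] poles by (simp only: not_False_eq_True)
    also have "\<dots> = (exp ((1 - - (2 * s)) * of_real (ln 2)) * of_real (1 / 4) powr s) * (of_real (sqrt pi) * Gamma (- (2 * s)))"
      by (simp only: mult_ac)
    also have "exp ((1 - - (2 * s)) * of_real (ln 2)) * of_real (1 / 4) powr s = 2"
      unfolding four exp_add[symmetric] by (simp add: algebra_simps exp_of_real)
    finally show ?thesis by (simp only: mult.assoc)
  qed
  have "sin (of_real pi * (1 / 2 + s)) = cos (of_real pi * s)"
    using sin_cos_eq[of "of_real pi * (1 / 2 + s)"] by (simp add: algebra_simps)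
  then have refl: "Gamma (1 / 2 + s) * Gamma (1 / 2 - s) = of_real pi / cos (of_real pi * s)"
    using Gamma_reflection_complex[of "1 / 2 + s"] by (simp add: algebra_simps)
  then have "cos (of_real pi * s) \<noteq> 0" using nz by auto
  with refl nz have cos: "cos (of_real pi * s) = of_real pi / (Gamma (1 / 2 + s) * Gamma (1 / 2 - s))"
    by (simp add: field_simps)
  have "2 * of_real (sqrt pi) * (Gamma (- (2 * s)) * cos (of_real pi * s)) =
      (2 * of_real (sqrt pi) * Gamma (- (2 * s))) * cos (of_real pi * s)" by simp
  also have "\<dots> = of_real pi * Gamma (- s) / Gamma (1 / 2 + s) * of_real (1 / 4) powr s"
    unfolding dup cos using nz by simp
  finally show ?thesis .
qed

text \<open>\<open>Z\<close> is a product of independent symmetric factors \<open>X i\<close> and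
  \<open>inverse (Y j)\<close>, indexed by a disjoint sum. The product formula is used on the line
  \<open>Re s = 2 * c\<close>, where \<open>2 * c > - 1\<close> ensures that the moments of the
  \<open>X i\<close> exist. The quotient by \<open>Gamma (1 / 2 + s)\<close> is left unsimplified so
  that \<open>card I = 0\<close> is included.\<close>

lemma (in prob_space) char_normal_ratio_mellin_barnes:
  fixes X :: "'i \<Rightarrow> 'a \<Rightarrow> real" and Y :: "'j \<Rightarrow> 'a \<Rightarrow> real"
  assumes fin: "finite I" "finite L" and ne: "0 < card I + card L"
    and indep: "indep_vars (\<lambda>_. borel) (case_sum X Y) (I <+> L)"
    and \<sigma>X: "\<And>i. i \<in> I \<Longrightarrow> 0 < \<sigma>X i" and \<sigma>Y: "\<And>j. j \<in> L \<Longrightarrow> 0 < \<sigma>Y j"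
    and X: "\<And>i. i \<in> I \<Longrightarrow> distributed M lborel (X i) (normal_density 0 (\<sigma>X i))"
    and Y: "\<And>j. j \<in> L \<Longrightarrow> distributed M lborel (Y j) (normal_density 0 (\<sigma>Y j))"
    and c: "- 1 / 2 < c" "c < 0" and t: "t \<noteq> 0"
  defines "Z \<equiv> \<lambda>\<omega>. (\<Prod>i\<in>I. X i \<omega>) / (\<Prod>j\<in>L. Y j \<omega>)"
    and "x \<equiv> 2 ^ card I * (\<Prod>i\<in>I. \<sigma>X i)\<^sup>2 * t\<^sup>2 / (2 ^ (card L + 2) * (\<Prod>j\<in>L. \<sigma>Y j)\<^sup>2)"
  defines "J \<equiv> \<lambda>s. Gamma (- s) * Gamma (1 / 2 - s) ^ card L * (Gamma (1 / 2 + s) ^ card I / Gamma (1 / 2 + s)) *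
      of_real x powr s"
  shows "integrable lborel (\<lambda>y. J (Complex c y))"
    and "(CLINT y|lborel. J (Complex c y)) =
      2 * of_real pi * of_real (pi powr ((real (card L) + real (card I) - 1) / 2)) * char (distr M borel Z) t"
proof -
  define U where "U k = (case k of Inl i \<Rightarrow> X i | Inr j \<Rightarrow> (\<lambda>\<omega>. inverse (Y j \<omega>)))" for k
  define \<mu> where "\<mu> k s = (case k of
      Inl i \<Rightarrow> of_real (\<sigma>X i * sqrt 2) powr s * Gamma ((s + 1) / 2) / of_real (sqrt pi)
    | Inr j \<Rightarrow> of_real (\<sigma>Y j * sqrt 2) powr (- s) * Gamma ((- s + 1) / 2) / of_real (sqrt pi))" for k and s :: complex
  let ?K = "I <+> L"
  have K: "finite ?K" "?K \<noteq> {}" using fin ne by auto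
  have U_indep: "indep_vars (\<lambda>_. borel) U ?K"
  proof -
    have "indep_vars (\<lambda>_. borel) (\<lambda>k \<omega>. (case k of Inl _ \<Rightarrow> \<lambda>r. r | Inr _ \<Rightarrow> inverse) (case_sum X Y k \<omega>)) ?K"
      by (rule indep_vars_compose2[OF indep]) (auto split: sum.split)
    also have "(\<lambda>k \<omega>. (case k of Inl _ \<Rightarrow> \<lambda>r. r | Inr _ \<Rightarrow> inverse) (case_sum X Y k \<omega>)) = U"
      by (auto simp: fun_eq_iff U_def split: sum.split)
    finally show ?thesis .
  qed
  have U_sym: "distr M borel (\<lambda>\<omega>. - U k \<omega>) = distr M borel (U k)" if "k \<in> ?K" for k
  proof (cases k)
    case (Inl i)
    then show ?thesis using that normal_distr_uminus[OF X \<sigma>X] by (auto simp: U_def)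
  next
    case (Inr j)
    with that have j: "j \<in> L" by auto
    have [measurable]: "Y j \<in> borel_measurable M" using distributed_measurable[OF Y[OF j]] by simp
    have "distr (distr M borel (\<lambda>\<omega>. - Y j \<omega>)) borel inverse = distr (distr M borel (Y j)) borel inverse"
      using normal_distr_uminus[OF Y \<sigma>Y, OF j j] by simp
    then show ?thesis
      unfolding Inr U_def by (subst (asm) (1 2) distr_distr) (auto simp: comp_def)
  qed
  have U_nz: "AE \<omega> in M. U k \<omega> \<noteq> 0" if "k \<in> ?K" for k
    using that normal_AE_nonzero[OF X] normal_AE_nonzero[OF Y] by (auto simp: U_def)
  have U_mom: "has_bochner_integral M (\<lambda>\<omega>. of_real \<bar>U k \<omega>\<bar> powr Complex (2 * c) y) (\<mu> k (Complex (2 * c) y))"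
    if "k \<in> ?K" for k y
  proof (cases k)
    case (Inl i)
    with that have "i \<in> I" by auto
    from normal_abs_powr_moment[OF X[OF this] \<sigma>X[OF this], of "Complex (2 * c) y"] c show ?thesis
      by (simp add: Inl U_def \<mu>_def)
  next
    case (Inr j)
    with that have "j \<in> L" by auto
    from normal_abs_powr_moment[OF Y[OF this] \<sigma>Y[OF this], of "- Complex (2 * c) y"] c show ?thesis
      by (simp only: Inr U_def \<mu>_def sum.case of_real_abs_inverse_powr) simp
  qed
  \<comment> \<open>The angle \<open>pi / 4\<close> is one choice below \<open>pi / 2\<close>. The
    Gamma factor of each moment is evaluated at height \<open>y / 2\<close> in absolute value, which
    halves the rate to \<open>pi / 8\<close>.\<close>
  have decay: "\<exists>C. \<forall>y. norm (\<mu> k (Complex (2 * c) y)) \<le> C * exp (- (pi / 8 * \<bar>y\<bar>))" if "k \<in> ?K" for k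
  proof (cases k)
    case (Inl i)
    with that have pos: "\<sigma>X i * sqrt 2 > 0" using \<sigma>X by auto
    obtain C where C: "\<And>y. norm (Gamma (Complex (c + 1 / 2) y)) \<le> C * exp (- (pi / 4 * \<bar>y\<bar>))"
      using Gamma_decay[of "c + 1 / 2" "pi / 4"] c by auto
    have "norm (\<mu> k (Complex (2 * c) y)) \<le> (\<sigma>X i * sqrt 2) powr (2 * c) * C / sqrt pi * exp (- (pi / 8 * \<bar>y\<bar>))" for y
    proof -
      have "(Complex (2 * c) y + 1) / 2 = Complex (c + 1 / 2) (y / 2)" by (simp add: complex_eq_iff)
      then have "norm (\<mu> k (Complex (2 * c) y)) =
          (\<sigma>X i * sqrt 2) powr (2 * c) / sqrt pi * norm (Gamma (Complex (c + 1 / 2) (y / 2)))"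
        using pos by (simp only: Inl \<mu>_def sum.case of_real_powr_Complex[OF less_imp_le]) (simp add: norm_mult norm_divide)
      also have "\<dots> \<le> (\<sigma>X i * sqrt 2) powr (2 * c) / sqrt pi * (C * exp (- (pi / 4 * \<bar>y / 2\<bar>)))"
        by (intro mult_left_mono C) auto
      finally show ?thesis by simp
    qed
    then show ?thesis by blast
  next
    case (Inr j)
    with that have pos: "\<sigma>Y j * sqrt 2 > 0" using \<sigma>Y by auto
    obtain C where C: "\<And>y. norm (Gamma (Complex (1 / 2 - c) y)) \<le> C * exp (- (pi / 4 * \<bar>y\<bar>))"
      using Gamma_decay[of "1 / 2 - c" "pi / 4"] c by auto
    have "norm (\<mu> k (Complex (2 * c) y)) \<le> (\<sigma>Y j * sqrt 2) powr (- 2 * c) * C / sqrt pi * exp (- (pi / 8 * \<bar>y\<bar>))" for y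
    proof -
      have "(- Complex (2 * c) y + 1) / 2 = Complex (1 / 2 - c) (- y / 2)" "- Complex (2 * c) y = Complex (- 2 * c) (- y)"
        by (simp_all add: complex_eq_iff)
      then have "norm (\<mu> k (Complex (2 * c) y)) =
          (\<sigma>Y j * sqrt 2) powr (- 2 * c) / sqrt pi * norm (Gamma (Complex (1 / 2 - c) (- y / 2)))"
        using pos by (simp only: Inr \<mu>_def sum.case of_real_powr_Complex[OF less_imp_le]) (simp add: norm_mult norm_divide)
      also have "\<dots> \<le> (\<sigma>Y j * sqrt 2) powr (- 2 * c) / sqrt pi * (C * exp (- (pi / 4 * \<bar>- y / 2\<bar>)))"
        by (intro mult_left_mono C) auto
      finally show ?thesis by simp
    qed
    then show ?thesis by blast
  qed
  define J0 where "J0 y = Gamma (- Complex (2 * c) y) * cos (of_real (pi / 2) * Complex (2 * c) y) *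
      of_real \<bar>t\<bar> powr Complex (2 * c) y * (\<Prod>k\<in>?K. \<mu> k (Complex (2 * c) y))" for y
  have Z_eq: "(\<lambda>\<omega>. \<Prod>k\<in>?K. U k \<omega>) = Z"
  proof
    fix \<omega>
    have "(\<Prod>j\<in>L. inverse (Y j \<omega>)) = inverse (\<Prod>j\<in>L. Y j \<omega>)"
      using prod_inversef[of "\<lambda>j. Y j \<omega>" L] by (simp add: comp_def)
    then show "(\<Prod>k\<in>?K. U k \<omega>) = Z \<omega>"
      using fin by (simp add: Z_def U_def prod.Plus divide_inverse comp_def)
  qed
  have "2 * c < 0" "0 < pi / 8" "pi / 8 < pi / 2" using c by auto
  note mb = char_prod_mellin_barnes[OF K U_indep U_sym U_nz this(1) U_mom this(2,3) decay t, folded J0_def, unfolded Z_eq]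
  \<comment> \<open>This is the dilation from \<open>s\<close> to \<open>2 * s\<close>: the point at
    height \<open>2 * y\<close> on the line \<open>Re = 2 * c\<close> is twice the point at height
    \<open>y\<close> on \<open>Re = c\<close>. The powers of \<open>sqrt pi\<close> clear the
    denominators of the moments.\<close>
  have kernel: "2 * of_real (sqrt pi) ^ (card I + card L) * J0 (2 * y) = of_real (sqrt pi) * J (Complex c y)" for y
  proof -
    define s where "s = Complex c y"
    have s: "Complex (2 * c) (2 * y) = 2 * s" by (simp add: s_def complex_eq_iff)
    have Re_s: "- 1 / 2 < Re s" "Re s < 0" using c by (simp_all add: s_def)
    let ?A = "of_real (t\<^sup>2) powr s" and ?B = "\<Prod>i\<in>I. of_real (2 * (\<sigma>X i)\<^sup>2) powr s"
      and ?C = "\<Prod>j\<in>L. of_real (inverse (2 * (\<sigma>Y j)\<^sup>2)) powr s" and ?D = "of_real (1 / 4) powr s"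
    have "(\<Prod>i\<in>I. 2 * (\<sigma>X i)\<^sup>2) = 2 ^ card I * (\<Prod>i\<in>I. \<sigma>X i)\<^sup>2"
      by (simp add: prod.distrib prod_power_distrib)
    then have B: "?B = of_real (2 ^ card I * (\<Prod>i\<in>I. \<sigma>X i)\<^sup>2) powr s"
      using of_real_prod_powr[of I "\<lambda>i. 2 * (\<sigma>X i)\<^sup>2" s] by simp
    have "(\<Prod>j\<in>L. inverse (2 * (\<sigma>Y j)\<^sup>2)) = inverse (\<Prod>j\<in>L. 2 * (\<sigma>Y j)\<^sup>2)"
      using prod_inversef[of "\<lambda>j. 2 * (\<sigma>Y j)\<^sup>2" L] by (simp only: comp_def)
    also have "\<dots> = inverse (2 ^ card L * (\<Prod>j\<in>L. \<sigma>Y j)\<^sup>2)"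
      by (simp add: prod.distrib prod_power_distrib)
    finally have C: "?C = of_real (inverse (2 ^ card L * (\<Prod>j\<in>L. \<sigma>Y j)\<^sup>2)) powr s"
      using of_real_prod_powr[of L "\<lambda>j. inverse (2 * (\<sigma>Y j)\<^sup>2)" s] by simp
    have mult4: "of_real (q1 * (q2 * (q3 * q4))) powr s =
        of_real q1 powr s * (of_real q2 powr s * (of_real q3 powr s * of_real q4 powr s))"
      if "0 \<le> q1" "0 \<le> q2" "0 \<le> q3" "0 \<le> q4" for q1 q2 q3 q4 :: real
      using that by (simp only: of_real_mult_powr mult_nonneg_nonneg)
    have x_eq: "x = t\<^sup>2 * ((2 ^ card I * (\<Prod>i\<in>I. \<sigma>X i)\<^sup>2) * (inverse (2 ^ card L * (\<Prod>j\<in>L. \<sigma>Y j)\<^sup>2) * (1 / 4)))"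
      by (simp add: x_def field_simps)
    have x: "of_real x powr s = ?A * (?B * (?C * ?D))"
      unfolding B C x_eq by (rule mult4) auto
    have X_mom: "(\<Prod>i\<in>I. \<mu> (Inl i) (2 * s)) = ?B * (Gamma (1 / 2 + s) / of_real (sqrt pi)) ^ card I"
    proof -
      have "\<mu> (Inl i) (2 * s) = of_real (2 * (\<sigma>X i)\<^sup>2) powr s * (Gamma (1 / 2 + s) / of_real (sqrt pi))" if "i \<in> I" for i
        using \<sigma>X[OF that] of_real_powr_double[of "\<sigma>X i * sqrt 2" s]
        by (simp add: \<mu>_def power_mult_distrib add_divide_distrib add.commute mult.commute[of 2])
      then show ?thesis by (simp only: prod.distrib prod_constant cong: prod.cong)
    qed
    have Y_mom: "(\<Prod>j\<in>L. \<mu> (Inr j) (2 * s)) = ?C * (Gamma (1 / 2 - s) / of_real (sqrt pi)) ^ card L"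
    proof -
      have "\<mu> (Inr j) (2 * s) = of_real (inverse (2 * (\<sigma>Y j)\<^sup>2)) powr s * (Gamma (1 / 2 - s) / of_real (sqrt pi))" if "j \<in> L" for j
      proof -
        have pos: "\<sigma>Y j * sqrt 2 > 0" using \<sigma>Y[OF that] by simp
        then have "of_real (\<sigma>Y j * sqrt 2) powr (- (2 * s)) = of_real (inverse (\<sigma>Y j * sqrt 2)) powr (2 * s)"
          using of_real_abs_inverse_powr[of "\<sigma>Y j * sqrt 2" "2 * s"]
          by (simp only: abs_of_pos positive_imp_inverse_positive)
        also have "\<dots> = of_real ((inverse (\<sigma>Y j * sqrt 2))\<^sup>2) powr s"
          using pos by (intro of_real_powr_double positive_imp_inverse_positive)
        also have "(inverse (\<sigma>Y j * sqrt 2))\<^sup>2 = inverse (2 * (\<sigma>Y j)\<^sup>2)"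
          by (simp add: power_mult_distrib power_inverse)
        finally have "of_real (\<sigma>Y j * sqrt 2) powr (- (2 * s)) = of_real (inverse (2 * (\<sigma>Y j)\<^sup>2)) powr s" .
        moreover have "(- (2 * s) + 1) / 2 = 1 / 2 - s" by (simp add: field_simps)
        ultimately show ?thesis by (simp only: \<mu>_def sum.case) simp
      qed
      then show ?thesis by (simp only: prod.distrib prod_constant cong: prod.cong)
    qed
    have tt: "of_real \<bar>t\<bar> powr (2 * s) = ?A"
      using of_real_powr_double[of "\<bar>t\<bar>" s] t by simp
    have J0: "J0 (2 * y) = Gamma (- (2 * s)) * cos (of_real pi * s) * ?A *
        ((?B * (Gamma (1 / 2 + s) / of_real (sqrt pi)) ^ card I) * (?C * (Gamma (1 / 2 - s) / of_real (sqrt pi)) ^ card L))"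
      unfolding J0_def s tt using fin X_mom Y_mom by (simp add: prod.Plus comp_def)
    \<comment> \<open>The additional \<open>sqrt pi\<close> is the one in
      \<open>Gamma_mellin_barnes_kernel\<close>; it is cancelled at the end by writing
      \<open>pi\<close> as its square.\<close>
    have "of_real (sqrt pi) * (2 * of_real (sqrt pi) ^ (card I + card L) * J0 (2 * y)) =
      (2 * of_real (sqrt pi) * (Gamma (- (2 * s)) * cos (of_real pi * s))) *
      (?A * ?B * ?C * Gamma (1 / 2 + s) ^ card I * Gamma (1 / 2 - s) ^ card L)"
      unfolding J0 by (simp add: power_divide power_add)
    also have "\<dots> = of_real pi * (Gamma (- s) * Gamma (1 / 2 - s) ^ card L *
       (Gamma (1 / 2 + s) ^ card I / Gamma (1 / 2 + s)) * of_real x powr s)"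
      unfolding Gamma_mellin_barnes_kernel[OF Re_s] x by simp
    also have "\<dots> = of_real (sqrt pi) * (of_real (sqrt pi) * J (Complex c y))"
      by (simp add: J_def s_def flip: of_real_mult mult.assoc)
    finally show ?thesis by simp
  qed
  then have J_eq: "J (Complex c y) = 2 * of_real (sqrt pi) ^ (card I + card L) / of_real (sqrt pi) * J0 (2 * y)" for y
    by (simp add: field_simps)
  have "integrable lborel (\<lambda>y. J0 (2 * y))"
    using lborel_integrable_real_affine[OF mb(1), of 2 0] by simp
  then show "integrable lborel (\<lambda>y. J (Complex c y))"
    unfolding J_eq by (rule integrable_mult_right)
  \<comment> \<open>Doubling the variable halves the integral, hence \<open>pi\<close> in place of
    \<open>2 * pi\<close>.\<close>
  have "(CLINT y|lborel. J0 (2 * y)) = of_real pi * char (distr M borel Z) t"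
    using lborel_integral_real_affine[of 2 J0 0] mb(2) by (simp add: scaleR_conv_of_real)
  then have "(CLINT y|lborel. J (Complex c y)) =
      2 * of_real (sqrt pi) ^ (card I + card L) / of_real (sqrt pi) * (of_real pi * char (distr M borel Z) t)"
    unfolding J_eq by (simp only: integral_mult_right_zero)
  moreover have "pi powr ((real (card L) + real (card I) - 1) / 2) = sqrt pi ^ (card I + card L) / sqrt pi"
  proof -
    have "pi powr ((real (card L) + real (card I) - 1) / 2) = (pi powr (1 / 2)) powr (real (card I + card L) - 1)"
      by (simp add: powr_powr add.commute)
    then show ?thesis by (simp add: powr_half_sqrt powr_diff powr_realpow del: of_nat_add)
  qed
  ultimately show "(CLINT y|lborel. J (Complex c y)) =
      2 * of_real pi * of_real (pi powr ((real (card L) + real (card I) - 1) / 2)) * char (distr M borel Z) t"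
    by simp
qed

section \<open>Identification with the Meijer integrals and the limit at the origin\<close>

theorem theorem2p4:
  fixes P :: "'a measure"
    and M N :: nat
    and X Y :: "nat \<Rightarrow> 'a \<Rightarrow> real"
    and \<sigma>X \<sigma>Y :: "nat \<Rightarrow> real"
    and Z :: "'a \<Rightarrow> real"
    and \<phi> :: "real \<Rightarrow> complex"
    and \<sigma> s c :: real
  assumes "prob_space P"
    and "prob_space.indep_vars P (\<lambda>_. borel) (case_sum X Y) ({1..M} <+> {1..N})"
    and "\<And>i. i \<in> {1..M} \<Longrightarrow> 0 < \<sigma>X i"
    and "\<And>j. j \<in> {1..N} \<Longrightarrow> 0 < \<sigma>Y j"
    and "\<And>i. i \<in> {1..M} \<Longrightarrow> distributed P lborel (X i) (normal_density 0 (\<sigma>X i))"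
    and "\<And>j. j \<in> {1..N} \<Longrightarrow> distributed P lborel (Y j) (normal_density 0 (\<sigma>Y j))"
    and "Z = (\<lambda>\<omega>. (\<Prod>i=1..M. X i \<omega>) / (\<Prod>j=1..N. Y j \<omega>))"
    and "\<phi> = char (distr P borel Z)"
    and "\<sigma> = (\<Prod>i=1..M. \<sigma>X i)"
    and "s = (\<Prod>j=1..N. \<sigma>Y j)"
    and "- 1 / 2 < c" and "c < 0"
  shows
    "(1 \<le> M \<longrightarrow>
       (let a = replicate (M - 1) (1 / 2);
            b = 0 # replicate N (1 / 2);
            x = (\<lambda>t. 2 ^ M * \<sigma>\<^sup>2 * t\<^sup>2 / (2 ^ (N + 2) * s\<^sup>2));
            R = (\<lambda>t. complex_of_real (1 / pi powr ((real N + real M - 1) / 2)) *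
                       meijer_G c (N + 1) (M - 1) a b (x t))
        in (\<forall>t. t \<noteq> 0 \<longrightarrow> meijer_G_converges c (N + 1) (M - 1) a b (x t) \<and> \<phi> t = R t) \<and>
           (R \<longlongrightarrow> \<phi> 0) (at 0))) \<and>
     (M = 0 \<and> 1 \<le> N \<longrightarrow>
       (let b = 0 # replicate (N + 1) (1 / 2);
            x = (\<lambda>t. t\<^sup>2 / (2 ^ (N + 2) * s\<^sup>2));
            R = (\<lambda>t. complex_of_real (1 / pi powr ((real N - 1) / 2)) *
                       meijer_G c (N + 1) 0 [] b (x t))
        in (\<forall>t. t \<noteq> 0 \<longrightarrow> meijer_G_converges c (N + 1) 0 [] b (x t) \<and> \<phi> t = R t) \<and>
           (R \<longlongrightarrow> \<phi> 0) (at 0)))"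
proof -
  interpret prob_space P by fact
  let ?J = "\<lambda>x s. Gamma (- s) * Gamma (1 / 2 - s) ^ N * (Gamma (1 / 2 + s) ^ M / Gamma (1 / 2 + s)) * of_real x powr s"
  let ?x = "\<lambda>t. 2 ^ M * \<sigma>\<^sup>2 * t\<^sup>2 / (2 ^ (N + 2) * s\<^sup>2)"
  have mb: "complex_integrable lborel (\<lambda>y. ?J (?x t) (Complex c y))"
    "(CLINT y|lborel. ?J (?x t) (Complex c y)) =
      2 * of_real pi * of_real (pi powr ((real N + real M - 1) / 2)) * \<phi> t"
    if "t \<noteq> 0" "1 \<le> M + N" for t
  proof -
    have "0 < card {1..M} + card {1..N}" using that(2) by auto
    note cn = char_normal_ratio_mellin_barnes[OF finite_atLeastAtMost finite_atLeastAtMost this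
        assms(2,3,4,5,6,11,12) that(1), unfolded card_atLeastAtMost diff_Suc_1 assms(7,8,9,10)[symmetric]]
    show "complex_integrable lborel (\<lambda>y. ?J (?x t) (Complex c y))"
      "(CLINT y|lborel. ?J (?x t) (Complex c y)) =
      2 * of_real pi * of_real (pi powr ((real N + real M - 1) / 2)) * \<phi> t"
      using cn by auto
  qed
  have "Z \<in> borel_measurable P"
  proof -
    have "X i \<in> borel_measurable P" if "i \<in> {1..M}" for i
      using distributed_measurable[OF assms(5)[OF that]] by simp
    moreover have "Y j \<in> borel_measurable P" if "j \<in> {1..N}" for j
      using distributed_measurable[OF assms(6)[OF that]] by simp
    ultimately show ?thesis unfolding assms(7)
      by (intro borel_measurable_divide borel_measurable_prod)
  qed
  then have "real_distribution (distr P borel Z)" by (rule real_distribution_distr)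
  then have cont: "\<phi> \<midarrow>0\<rightarrow> \<phi> 0"
    using real_distribution.isCont_char[of _ 0] unfolding assms(8) by (simp add: isCont_def)
  \<comment> \<open>The limit at 0 follows from continuity of the characteristic function: any
    \<open>R\<close> that agrees with \<open>\<phi>\<close> away from 0 tends to
    \<open>\<phi> 0\<close>.\<close>
  have lim: "(R \<longlongrightarrow> \<phi> 0) (at 0)" if "\<And>t. t \<noteq> 0 \<Longrightarrow> \<phi> t = R t" for R
    using cont by (rule Lim_transform_eventually) (auto simp: eventually_at_filter that)
  \<comment> \<open>The first \<open>N + 1\<close> lower parameters are \<open>0\<close> and
    \<open>N\<close> halves. Here \<open>r\<close> is \<open>N\<close> in case (i) and
    \<open>N + 1\<close> in case (ii), where one more half remains for the denominator.\<close>
  have prod_b: "(\<Prod>j<Suc N. Gamma ((0 # replicate r (1 / 2)) ! j - z)) = Gamma (- z) * Gamma (1 / 2 - z) ^ N"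
    if "N \<le> r" for r and z :: complex
    using that by (simp add: prod.lessThan_Suc_shift del: prod.lessThan_Suc)
  \<comment> \<open>The factor \<open>\<i>\<close> from \<open>ds = \<i> dy\<close> cancels the one
    in the prefactor of the contour integral.\<close>
  have G_eq: "complex_integrable lborel (\<lambda>y. f y * \<i>) \<and>
      w = of_real (1 / pi powr r) * (1 / (2 * of_real pi * \<i>) * (CLINT y|lborel. f y * \<i>))"
    if "complex_integrable lborel f" "integral\<^sup>L lborel f = 2 * of_real pi * of_real (pi powr r) * w" for f r w
    using that by simp
  show ?thesis
  proof (intro conjI impI)
    assume M: "1 \<le> M"
    define a where "a = replicate (M - 1) (1 / 2 :: complex)"
    define b where "b = 0 # replicate N (1 / 2 :: complex)"
    have prod_a: "(\<Prod>j<M - 1. Gamma (1 - a ! j + z)) = Gamma (1 / 2 + z) ^ (M - 1)" for z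
      by (simp add: a_def)
    \<comment> \<open>With \<open>M\<close> at least 1, one factor \<open>Gamma (1 / 2 + s)\<close>
      cancels; it is nonzero on the line because \<open>c > - 1 / 2\<close>.\<close>
    have int: "meijer_integrand (N + 1) (M - 1) a b x (Complex c y) = ?J x (Complex c y)" for x y
    proof -
      have "Gamma (1 / 2 + Complex c y) \<noteq> 0"
        using assms(11) by (intro Gamma_nonzero_Re_pos) simp
      then have "Gamma (1 / 2 + Complex c y) ^ M / Gamma (1 / 2 + Complex c y) = Gamma (1 / 2 + Complex c y) ^ (M - 1)"
        using M by (cases M) auto
      moreover have "length a = M - 1" "length b = N + 1" by (simp_all add: a_def b_def)
      ultimately show ?thesis
        unfolding meijer_integrand_def prod_a using prod_b[of N] by (simp add: b_def)
    qed
    have main: "meijer_G_converges c (N + 1) (M - 1) a b (?x t) \<and>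
        \<phi> t = of_real (1 / pi powr ((real N + real M - 1) / 2)) * meijer_G c (N + 1) (M - 1) a b (?x t)"
      if "t \<noteq> 0" for t
      unfolding meijer_G_converges_def meijer_G_def int using M by (intro G_eq mb[OF that]) auto
    show "let a = replicate (M - 1) (1 / 2); b = 0 # replicate N (1 / 2); x = ?x;
        R = (\<lambda>t. of_real (1 / pi powr ((real N + real M - 1) / 2)) * meijer_G c (N + 1) (M - 1) a b (x t))
      in (\<forall>t. t \<noteq> 0 \<longrightarrow> meijer_G_converges c (N + 1) (M - 1) a b (x t) \<and> \<phi> t = R t) \<and> (R \<longlongrightarrow> \<phi> 0) (at 0)"
      unfolding Let_def a_def[symmetric] b_def[symmetric]
      by (intro conjI allI impI lim main[THEN conjunct1] main[THEN conjunct2])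
  next
    assume MN: "M = 0 \<and> 1 \<le> N"
    define b where "b = 0 # replicate (N + 1) (1 / 2 :: complex)"
    \<comment> \<open>For \<open>M = 0\<close> the empty product makes \<sigma> equal to 1.\<close>
    have x: "?x t = t\<^sup>2 / (2 ^ (N + 2) * s\<^sup>2)" for t
      using MN assms(9) by simp
    \<comment> \<open>The lower parameter of index \<open>N + 1\<close> supplies the factor
      \<open>Gamma (1 / 2 + z)\<close> in the denominator, and the power with exponent
      \<open>M = 0\<close> in \<open>?J\<close> is 1.\<close>
    have int: "meijer_integrand (N + 1) 0 [] b x z = ?J x z" for x z
    proof -
      have "(\<Prod>j = N + 1..<length b. Gamma (1 - b ! j + z)) = Gamma (1 / 2 + z)"
        by (simp add: b_def del: replicate_Suc)
      then show ?thesis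
        unfolding meijer_integrand_def using prod_b[of "N + 1"] MN by (simp add: b_def del: replicate_Suc)
    qed
    have main: "meijer_G_converges c (N + 1) 0 [] b (t\<^sup>2 / (2 ^ (N + 2) * s\<^sup>2)) \<and>
        \<phi> t = of_real (1 / pi powr ((real N - 1) / 2)) * meijer_G c (N + 1) 0 [] b (t\<^sup>2 / (2 ^ (N + 2) * s\<^sup>2))"
      if "t \<noteq> 0" for t
      using G_eq[OF mb[OF that]] MN
      unfolding meijer_G_converges_def meijer_G_def int x by simp
    show "let b = 0 # replicate (N + 1) (1 / 2); x = \<lambda>t. t\<^sup>2 / (2 ^ (N + 2) * s\<^sup>2);
        R = (\<lambda>t. of_real (1 / pi powr ((real N - 1) / 2)) * meijer_G c (N + 1) 0 [] b (x t))
      in (\<forall>t. t \<noteq> 0 \<longrightarrow> meijer_G_converges c (N + 1) 0 [] b (x t) \<and> \<phi> t = R t) \<and> (R \<longlongrightarrow> \<phi> 0) (at 0)"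
      unfolding Let_def b_def[symmetric]
      by (intro conjI allI impI lim main[THEN conjunct1] main[THEN conjunct2])
  qed
qed

end
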